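(* Let $(S_n)$ be the elephant random walk with memory parameter $p$ in the superdiffusive regime $3/4<p\le1$ and first-step parameter $q\in[0,1]$. Let $L$ be the almost sure limit of $S_n/n^{2p-1}$ and let $V_n=4\sum_{k=1}^{n-1}(S_k/k)^2$. For any $0<\alpha<1$, conditionally on the event $\{L^2>0\}$, the interval $$\mathcal{I}(p)=\Bigl[\widehat{p}_n-\frac{1}{\sqrt{V_n}}\,t_{1-\alpha/2},\ \ \widehat{p}_n+\frac{1}{\sqrt{V_n}}\,t_{1-\alpha/2}\Bigr]$$ is an asymptotic confidence interval for $p$ with confidence level $1-\alpha$, that is, $\lim_{n\to\infty}\mathbb{P}(p\in\mathcal{I}(p)\mid L^2>0)=1-\alpha$, where $t_{1-\alpha/2}$ stands for the $(1-\alpha/2)$-quantile of the standard $\mathcal{N}(0,1)$ distribution.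
   Context: Elephant random walk (ERW): fix $q\in[0,1]$ and $p\in[0,1]$. Set $S_0=0$. The first step $X_1$ equals $+1$ with probability $q$ and $-1$ with probability $1-q$. For each $n\ge 1$, an integer $k$ is chosen uniformly at random among $1,\dots,n$ (independently of the past), and $X_{n+1}=X_k$ with probability $p$, $X_{n+1}=-X_k$ with probability $1-p$. The position is $S_{n+1}=S_n+X_{n+1}$, so $S_n=X_1+\cdots+X_n$. Equivalently, with $\mathcal{F}_n=\sigma(X_1,\dots,X_n)$, $\mathbb{P}(X_{n+1}=1\mid\mathcal{F}_n)=\frac12\bigl(1+(2p-1)\frac{S_n}{n}\bigr)$ and $\mathbb{P}(X_{n+1}=-1\mid\mathcal{F}_n)=\frac12\bigl(1-(2p-1)\frac{S_n}{n}\bigr)$ for all $n\ge1$. Estimator: for all $n\ge2$, $$\widehat{p}_n=\frac{\sum_{k=1}^{n-1}\frac{S_k}{k}\bigl(X_{k+1}+\frac{S_k}{k}\bigr)}{2\sum_{k=1}^{n-1}\bigl(\frac{S_k}{k}\bigr)^2}.$$ Known fact used to define $L$: in the superdiffusive regime $3/4<p\le1$, $S_n/n^{2p-1}$ converges almost surely to a random variable $L$, which the paper recalls as non-degenerate.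
   Formalization: The endpoint p = 1 is excluded (3/4 < p < 1 instead of 3/4 < p ≤ 1): at p = 1 all steps equal X_1 almost surely, so the estimator equals p exactly and the coverage probability is 1 for every n ≥ 2 rather than tending to 1 − α. *)

theory Defs
  imports "HOL-Probability.Probability"
begin

text \<open>
  The time index of the steps starts at 1; the value of \<open>X 0\<close> is never used.
  At time \<open>n \<ge> 1\<close> the elephant recalls the uniformly chosen instant \<open>K n\<close>, and \<open>Z n\<close> tells
  whether the recalled step is repeated (with probability \<open>p\<close>) or reversed.  The product
  distribution of \<open>(K n, Z n)\<close> says that \<open>K n\<close> is uniform, \<open>Z n\<close> is Bernoulli and the two are
  independent; \<open>indep_past\<close> says that the pair is independent of \<open>\<sigma>(X 1, \<dots>, X n)\<close>.
\<close>

locale elephant_random_walk = prob_space M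
  for M :: "'a measure" +
  fixes p q :: real
    and X :: "nat \<Rightarrow> 'a \<Rightarrow> real"
    and K :: "nat \<Rightarrow> 'a \<Rightarrow> nat"
    and Z :: "nat \<Rightarrow> 'a \<Rightarrow> bool"
  assumes p_range: "p \<in> {0..1}"
    and q_range: "q \<in> {0..1}"
    and X_measurable: "\<And>n. n \<ge> 1 \<Longrightarrow> random_variable borel (X n)"
    and first_step_plus: "\<P>(w in M. X 1 w = 1) = q"
    and first_step_minus: "\<P>(w in M. X 1 w = -1) = 1 - q"
    and choice_measurable: "\<And>n. n \<ge> 1 \<Longrightarrow>
          random_variable (count_space UNIV) (\<lambda>w. (K n w, Z n w))"
    and choice_distr: "\<And>n. n \<ge> 1 \<Longrightarrow>
          distr M (count_space UNIV) (\<lambda>w. (K n w, Z n w)) =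
          measure_pmf (pair_pmf (pmf_of_set {1..n}) (bernoulli_pmf p))"
    and indep_past: "\<And>n. n \<ge> 1 \<Longrightarrow>
          indep_set
            (sets (vimage_algebra (space M) (\<lambda>w. \<lambda>i\<in>{1..n}. X i w) (Pi\<^sub>M {1..n} (\<lambda>_. borel))))
            (sets (vimage_algebra (space M) (\<lambda>w. (K n w, Z n w)) (count_space UNIV)))"
    and step: "\<And>n. n \<ge> 1 \<Longrightarrow>
          AE w in M. X (Suc n) w = (if Z n w then X (K n w) w else - X (K n w) w)"

definition position :: "(nat \<Rightarrow> 'a \<Rightarrow> real) \<Rightarrow> nat \<Rightarrow> 'a \<Rightarrow> real" where
  "position X n w = (\<Sum>k=1..n. X k w)"

definition p_hat :: "(nat \<Rightarrow> 'a \<Rightarrow> real) \<Rightarrow> nat \<Rightarrow> 'a \<Rightarrow> real" where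
  "p_hat X n w =
     (\<Sum>k=1..n-1. position X k w / real k * (X (k+1) w + position X k w / real k)) /
     (2 * (\<Sum>k=1..n-1. (position X k w / real k)\<^sup>2))"

definition V :: "(nat \<Rightarrow> 'a \<Rightarrow> real) \<Rightarrow> nat \<Rightarrow> 'a \<Rightarrow> real" where
  "V X n w = 4 * (\<Sum>k=1..n-1. (position X k w / real k)\<^sup>2)"

definition quantile :: "real measure \<Rightarrow> real \<Rightarrow> real" where
  "quantile D u = Inf {x. u \<le> cdf D x}"

definition conf_interval :: "(nat \<Rightarrow> 'a \<Rightarrow> real) \<Rightarrow> real \<Rightarrow> nat \<Rightarrow> 'a \<Rightarrow> real set" where
  "conf_interval X \<alpha> n w =
     (let t = quantile std_normal_distribution (1 - \<alpha> / 2)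
      in {p_hat X n w - 1 / sqrt (V X n w) * t .. p_hat X n w + 1 / sqrt (V X n w) * t})"

end

theory Submission
  imports Defs
begin

text \<open>
  Put \<open>a = 2 p - 1\<close>.  With \<open>c\<^sub>n = \<Prod>k<n. (1 + a / k)\<close>, which grows like \<open>n\<close> to the power \<open>a\<close>,
  the quotient \<open>M\<^sub>n = S\<^sub>n / c\<^sub>n\<close> is a martingale, bounded in \<open>L\<^sup>2\<close> because \<open>a > 1/2\<close>; its limit is a
  positive multiple of \<open>L\<close>, and \<open>E[M\<^sub>n\<^sup>2] \<ge> 1\<close> forces \<open>P(L \<noteq> 0) > 0\<close>.

  Let \<open>\<xi>\<^sub>k = X\<^sub>k\<^sub>+\<^sub>1 - a S\<^sub>k / k\<close>.  Solving for \<open>p\<close>, the event that \<open>p\<close> lies in the interval reads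
  \<open>|\<Sum> (S\<^sub>k / k) \<xi>\<^sub>k| \<le> t sqrt (\<Sum> (S\<^sub>k / k)\<^sup>2)\<close>.  As
  \<open>S\<^sub>k / k = M\<^sub>k c\<^sub>k / k\<close>, replacing \<open>M\<^sub>k\<close> by its limit costs little in \<open>L\<^sup>1\<close>, so both sides are
  asymptotically \<open>|L|\<close> times the quantities with the deterministic weights \<open>c\<^sub>k / k\<close>.  For these weights
  the conditional variances of the normalised sum \<open>U\<^sub>n\<close> add up to a deterministic limit, because
  \<open>S\<^sub>k / k\<close> tends to 0, and a telescoping estimate of \<open>E[Y exp(i \<theta> U\<^sub>n)]\<close> for bounded \<open>Y\<close> depending on
  finitely many steps shows that \<open>U\<^sub>n\<close> is asymptotically normal and independent of the past, hence
  also conditionally on \<open>L \<noteq> 0\<close>.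
\<close>

section \<open>Growth rates of the normalising sequences\<close>

text \<open>The obstacle is that the conditional variances of the sum to be normalised add up to a
  random quantity, asymptotically a multiple of L^2, while L is not known at any finite time.
  Putting L into the coefficients would destroy the martingale structure. The coefficients are
  therefore frozen at a fixed time m first, which keeps them predictable, and the martingale at time
  m is compared with its limit only in mean square. With deterministic weights the conditional
  characteristic function of each step is close to a deterministic Gaussian factor. Such a factor
  leaves the expectation even in the presence of a bounded Y depending on the past, which is the
  source of the asymptotic independence. Conditional expectations never occur explicitly: the law of
  the next step is always expressed by testing against a bounded function of the past. The bound a >
  1/2 makes the inverse squares of \<open>growth\<close> summable. The squared weights still have a
  divergent sum, so finitely many steps are negligible after normalisation. The bound a < 1 sends
  S_k / k to 0, so that the conditional variance 1 - (a S_k / k)^2 of a step tends to 1.\<close>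

definition growth :: "real \<Rightarrow> nat \<Rightarrow> real" where
  "growth a n = (\<Prod>k=1..<n. 1 + a / real k)"

lemma growth_1 [simp]: "growth a (Suc 0) = 1"
  by (simp add: growth_def)

lemma growth_Suc: "n \<ge> 1 \<Longrightarrow> growth a (Suc n) = growth a n * (1 + a / real n)"
  by (simp add: growth_def prod.atLeastLessThan_Suc)

lemma growth_ge_1: "a \<ge> 0 \<Longrightarrow> growth a n \<ge> 1"
  unfolding growth_def by (rule prod_ge_1) auto

lemma growth_pos: "a \<ge> 0 \<Longrightarrow> growth a n > 0"
  using growth_ge_1[of a n] by linarith

definition weight :: "real \<Rightarrow> nat \<Rightarrow> real" where
  "weight a k = growth a k / real k"

lemma weight_Suc: "k \<ge> 1 \<Longrightarrow> weight a (Suc k) = weight a k * ((real k + a) / (real k + 1))"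
  by (simp add: weight_def growth_Suc field_simps)

lemma weight_pos: "a \<ge> 0 \<Longrightarrow> k \<ge> 1 \<Longrightarrow> weight a k > 0"
  by (simp add: weight_def growth_pos)

lemma weight_le_1:
  assumes "0 \<le> a" "a \<le> 1" "k \<ge> 1"
  shows "weight a k \<le> 1"
  using \<open>k \<ge> 1\<close>
proof (induction k rule: dec_induct)
  case base
  then show ?case by (simp add: weight_def)
next
  case (step n)
  have "weight a (Suc n) = weight a n * ((real n + a) / (real n + 1))"
    using step by (intro weight_Suc) auto
  also have "\<dots> \<le> 1 * 1"
    using step assms by (intro mult_mono) auto
  finally show ?case by simp
qed

text \<open>Since (n + a)^2 \<ge> (n + 1/2)^2 \<ge> n (n + 1), one step multiplies the squared
  weight by at least n / (n + 1), exactly the decay of 1 / n. Comparison with the harmonic series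
  then gives divergence without any asymptotic expansion.\<close>

lemma weight_sq_ge:
  assumes "1 / 2 \<le> a" "k \<ge> 1"
  shows "1 / real k \<le> (weight a k)\<^sup>2"
  using \<open>k \<ge> 1\<close>
proof (induction k rule: dec_induct)
  case base
  then show ?case by (simp add: weight_def)
next
  case (step n)
  have n: "real n > 0" using step by simp
  have "real n * (real n + 1) \<le> (real n + 1 / 2)\<^sup>2"
    by (simp add: power2_eq_square algebra_simps)
  also have "\<dots> \<le> (real n + a)\<^sup>2"
    using assms by (intro power_mono) auto
  finally have "real n * (real n + 1) / (real n * (real n + 1)\<^sup>2) \<le> (real n + a)\<^sup>2 / (real n * (real n + 1)\<^sup>2)"
    by (intro divide_right_mono) auto
  moreover have "real n * (real n + 1) / (real n * (real n + 1)\<^sup>2) = 1 / real (Suc n)"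
    using n by (simp add: power2_eq_square)
  moreover have "(real n + a)\<^sup>2 / (real n * (real n + 1)\<^sup>2) = 1 / real n * ((real n + a) / (real n + 1))\<^sup>2"
    by (simp add: power_divide)
  ultimately have "1 / real (Suc n) \<le> 1 / real n * ((real n + a) / (real n + 1))\<^sup>2"
    by simp
  also have "\<dots> \<le> (weight a n)\<^sup>2 * ((real n + a) / (real n + 1))\<^sup>2"
    using step by (intro mult_right_mono) auto
  also have "\<dots> = (weight a (Suc n))\<^sup>2"
    using step by (simp add: weight_Suc power_mult_distrib power_divide)
  finally show ?case .
qed

text \<open>For n \<ge> 1, \<open>growth a n\<close> is Gamma(n + a) / (Gamma(n) Gamma(1 + a)), so
  the limit is 1 / Gamma(1 + a); it is read off from the product formula for the reciprocal Gamma
  function.\<close>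

lemma growth_asymptotics:
  assumes "a > 0"
  obtains \<rho> where "\<rho> > 0" "(\<lambda>n. growth a n / real n powr a) \<longlonglongrightarrow> \<rho>"
proof
  show "rGamma a / a > 0"
    using assms by (simp add: rGamma_inverse_Gamma Gamma_real_pos)
  have poch: "pochhammer a (Suc n) = a * fact n * growth a (Suc n)" for n
  proof (induction n)
    case (Suc n)
    have "pochhammer a (Suc (Suc n)) = pochhammer a (Suc n) * (a + real (Suc n))"
      by (simp add: pochhammer_Suc)
    also have "\<dots> = a * fact (Suc n) * growth a (Suc (Suc n))"
      unfolding Suc by (simp add: growth_Suc[of "Suc n"] field_simps)
    finally show ?case .
  qed simp
  \<comment> \<open>The series contains \<open>pochhammer a (Suc n)\<close> and hence
    \<open>growth a (Suc n)\<close>; dividing by \<open>1 + a / real n\<close>, which tends to 1,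
    shifts the index back to n.\<close>
  have "(\<lambda>n. rGamma_series a n / a / (1 + a / real n)) \<longlonglongrightarrow> rGamma a / a / (1 + 0)"
    by (intro tendsto_intros rGamma_series_LIMSEQ lim_const_over_n) (use assms in auto)
  moreover have "eventually (\<lambda>n. rGamma_series a n / a / (1 + a / real n) = growth a n / real n powr a) sequentially"
    using eventually_ge_at_top[of 1]
  proof eventually_elim
    case (elim n)
    have "1 + a / real n > 0" using assms elim by (simp add: field_simps add_pos_pos)
    then show ?case
      using elim assms poch[of n]
      by (simp add: rGamma_series_def powr_def growth_Suc)
  qed
  ultimately show "(\<lambda>n. growth a n / real n powr a) \<longlonglongrightarrow> rGamma a / a"
    by (simp add: filterlim_cong)
qed

text \<open>The weight behaves like n to the power a - 1. For a = 1 it is constantly 1, so the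
  strict inequality matters here.\<close>

lemma weight_tendsto_0:
  assumes "0 < a" "a < 1"
  shows "weight a \<longlonglongrightarrow> 0"
proof -
  obtain \<rho> where \<rho>: "(\<lambda>n. growth a n / real n powr a) \<longlonglongrightarrow> \<rho>"
    using growth_asymptotics[OF \<open>0 < a\<close>] by metis
  have "(\<lambda>n. real n powr (a - 1)) \<longlonglongrightarrow> 0"
    using assms by (intro tendsto_neg_powr filterlim_real_sequentially) auto
  from tendsto_mult[OF \<rho> this] have "(\<lambda>n. growth a n / real n powr a * real n powr (a - 1)) \<longlonglongrightarrow> 0"
    by simp
  moreover have "eventually (\<lambda>n. growth a n / real n powr a * real n powr (a - 1) = weight a n) sequentially"
    using eventually_ge_at_top[of 1]
    by eventually_elim (simp add: weight_def powr_diff)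
  ultimately show ?thesis
    by (simp add: filterlim_cong)
qed

text \<open>The increments of the normalised walk are \<open>noise\<close> divided by
  \<open>growth\<close>, so this series controls their total mean square. The condition 2 a > 1 is
  precisely p > 3/4.\<close>

lemma summable_inverse_growth_sq:
  assumes "1 / 2 < a"
  shows "summable (\<lambda>n. 1 / (growth a n)\<^sup>2)"
proof -
  obtain \<rho> where \<rho>: "\<rho> > 0" "(\<lambda>n. growth a n / real n powr a) \<longlonglongrightarrow> \<rho>"
    using growth_asymptotics[of a] assms by auto
  have "eventually (\<lambda>n. growth a n / real n powr a > \<rho> / 2) sequentially"
    using \<rho> by (intro order_tendstoD(1)[of _ \<rho>]) auto
  then have "eventually (\<lambda>n. norm (1 / (growth a n)\<^sup>2) \<le> 4 / \<rho>\<^sup>2 * real n powr (- 2 * a)) sequentially"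
    using eventually_ge_at_top[of 1]
  proof eventually_elim
    case (elim n)
    have "growth a n \<ge> \<rho> / 2 * real n powr a" using elim by (simp add: field_simps)
    then have "(growth a n)\<^sup>2 \<ge> (\<rho> / 2 * real n powr a)\<^sup>2"
      using \<rho> by (intro power_mono) auto
    then have "1 / (growth a n)\<^sup>2 \<le> 1 / (\<rho> / 2 * real n powr a)\<^sup>2"
      using \<rho> elim by (intro divide_left_mono mult_pos_pos) (auto intro: order.strict_trans2[rotated])
    also have "\<dots> = 4 / \<rho>\<^sup>2 * real n powr (- 2 * a)"
      using elim by (simp add: power_mult_distrib powr_power powr_minus field_simps)
    finally show ?case by simp
  qed
  moreover have "summable (\<lambda>n. 4 / \<rho>\<^sup>2 * real n powr (- 2 * a))"
    using assms by (intro summable_mult) (simp add: summable_real_powr_iff)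
  ultimately show ?thesis
    by (rule summable_comparison_test_ev)
qed

text \<open>A Toeplitz averaging argument: once the total weight diverges, any initial segment is
  negligible. It serves both for the mean variance defect and for the pathwise limit of the random
  normalisation.\<close>

lemma weighted_average_tendsto:
  fixes w x :: "nat \<Rightarrow> real"
  assumes w: "\<And>k. k \<ge> 1 \<Longrightarrow> w k \<ge> 0"
    and W: "filterlim (\<lambda>n. \<Sum>k=1..<n. w k) at_top sequentially"
    and x: "x \<longlonglongrightarrow> l"
  shows "(\<lambda>n. (\<Sum>k=1..<n. w k * x k) / (\<Sum>k=1..<n. w k)) \<longlonglongrightarrow> l"
proof (rule LIMSEQ_I)
  fix e :: real assume e: "e > 0"
  define W where "W n = (\<Sum>k=1..<n. w k)" for n
  obtain m where m: "m \<ge> 1" "\<And>k. k \<ge> m \<Longrightarrow> \<bar>x k - l\<bar> < e / 2"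
  proof -
    obtain m where "\<And>k. k \<ge> m \<Longrightarrow> \<bar>x k - l\<bar> < e / 2"
      using LIMSEQ_D[OF x, of "e / 2"] e by auto
    then show ?thesis using that[of "max 1 m"] by auto
  qed
  \<comment> \<open>The contribution of the indices before m does not depend on n and is at most
    half of e times the total weight as soon as that weight reaches 2 C / e; the extra 1 makes the
    inequality strict.\<close>
  define C where "C = (\<Sum>k=1..<m. w k * \<bar>x k - l\<bar>)"
  have "eventually (\<lambda>n. W n \<ge> 2 * C / e + 1) sequentially"
    using W unfolding W_def filterlim_at_top by blast
  moreover have "eventually (\<lambda>n. n \<ge> m) sequentially" by simp
  ultimately have "eventually (\<lambda>n. norm ((\<Sum>k=1..<n. w k * x k) / W n - l) < e) sequentially"
  proof eventually_elim
    case (elim n)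
    have C0: "C \<ge> 0" unfolding C_def by (intro sum_nonneg mult_nonneg_nonneg w) auto
    then have Wpos: "W n > 0" using elim e by (smt (verit) divide_nonneg_pos)
    have "\<bar>(\<Sum>k=1..<n. w k * x k) - l * W n\<bar> = \<bar>\<Sum>k=1..<n. w k * (x k - l)\<bar>"
      by (simp add: W_def sum_distrib_left sum_subtractf algebra_simps)
    also have "\<dots> \<le> (\<Sum>k=1..<n. w k * \<bar>x k - l\<bar>)"
      by (rule sum_abs[THEN order_trans]) (auto intro!: sum_mono simp: abs_mult w)
    also have "\<dots> = C + (\<Sum>k=m..<n. w k * \<bar>x k - l\<bar>)"
      unfolding C_def using elim m by (subst sum.atLeastLessThan_concat) auto
    also have "(\<Sum>k=m..<n. w k * \<bar>x k - l\<bar>) \<le> (\<Sum>k=m..<n. w k * (e / 2))"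
      using m w by (intro sum_mono mult_left_mono) (auto intro: less_imp_le)
    also have "\<dots> \<le> (\<Sum>k=1..<n. w k * (e / 2))"
      using m e by (intro sum_mono2) (auto intro!: mult_nonneg_nonneg w)
    also have "\<dots> = W n * (e / 2)" by (simp add: W_def sum_distrib_right)
    finally have "\<bar>(\<Sum>k=1..<n. w k * x k) - l * W n\<bar> \<le> C + W n * (e / 2)" by simp
    moreover have "C < W n * (e / 2)"
      using elim e by (simp add: field_simps)
    ultimately have "\<bar>(\<Sum>k=1..<n. w k * x k) - l * W n\<bar> < W n * e" by argo
    then show ?case
      using Wpos by (simp add: abs_less_iff field_simps)
  qed
  then show "\<exists>no. \<forall>n\<ge>no. norm ((\<Sum>k=1..<n. w k * x k) / (\<Sum>k=1..<n. w k) - l) < e"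
    by (simp add: eventually_sequentially W_def)
qed

definition weight_norm_sq :: "real \<Rightarrow> nat \<Rightarrow> real" where
  "weight_norm_sq a n = (\<Sum>k=1..<n. (weight a k)\<^sup>2)"

lemma weight_norm_sq_at_top:
  assumes "1 / 2 \<le> a"
  shows "filterlim (weight_norm_sq a) at_top sequentially"
proof -
  have "filterlim (\<lambda>n. harm (n - 1) :: real) at_top sequentially"
    by (rule filterlim_compose[OF harm_at_top filterlim_minus_const_nat_at_top])
  then show ?thesis
  proof (rule filterlim_at_top_mono)
    show "eventually (\<lambda>n. harm (n - 1) \<le> weight_norm_sq a n) sequentially"
      using eventually_ge_at_top[of 1]
    proof eventually_elim
      case (elim n)
      then have "{1..n - 1} = {1..<n}" by auto
      then show ?case
        unfolding harm_def weight_norm_sq_def using weight_sq_ge[OF assms]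
        by (auto intro!: sum_mono simp: inverse_eq_divide)
    qed
  qed
qed

lemma weight_norm_sq_ge_1:
  assumes "0 \<le> a" "n \<ge> 2"
  shows "weight_norm_sq a n \<ge> 1"
proof -
  have "(weight a 1)\<^sup>2 \<le> weight_norm_sq a n"
    unfolding weight_norm_sq_def using assms by (intro member_le_sum) auto
  then show ?thesis by (simp add: weight_def)
qed

section \<open>Symmetric intervals under the standard normal distribution\<close>

text \<open>Dominated convergence applied to the indicators; the events may vary with n without any
  monotonicity.\<close>

lemma (in prob_space) prob_tendsto_0:
  assumes [measurable]: "\<And>n. {w \<in> space M. P n w} \<in> events"
    and ev: "AE w in M. eventually (\<lambda>n. \<not> P n w) sequentially"
  shows "(\<lambda>n. prob {w \<in> space M. P n w}) \<longlonglongrightarrow> 0"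
proof -
  have "(\<lambda>n. LINT w|M. indicator {w \<in> space M. P n w} w) \<longlonglongrightarrow> (LINT w|M. (0 :: real))"
  proof (rule integral_dominated_convergence[where w="\<lambda>_. 1"])
    show "AE w in M. (\<lambda>n. indicator {w \<in> space M. P n w} w) \<longlonglongrightarrow> (0 :: real)"
      using ev
    proof eventually_elim
      case (elim w)
      then show ?case
        by (intro tendsto_eventually) (auto elim!: eventually_mono simp: indicator_def)
    qed
  qed (auto simp: indicator_def)
  then show ?thesis by simp
qed

interpretation std_normal: real_distribution std_normal_distribution
  by (rule real_dist_normal_dist)

lemma measure_std_normal_singleton: "measure std_normal_distribution {x} = 0"
proof -
  have "emeasure std_normal_distribution {x} = 0"
    by (subst emeasure_density) (auto intro!: nn_integral_null_set[THEN trans] simp: null_sets_def emeasure_lborel_countable)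
  then show ?thesis by (simp add: measure_def)
qed

lemma isCont_cdf_std_normal: "isCont (cdf std_normal_distribution) x"
  by (simp add: std_normal.isCont_cdf measure_std_normal_singleton)

text \<open>The characteristic function exp(- t^2 / 2) is even, so reflection leaves it unchanged
  and uniqueness of characteristic functions gives the symmetry.\<close>

lemma distr_uminus_std_normal: "distr std_normal_distribution borel uminus = std_normal_distribution"
proof (rule Levy_uniqueness)
  show "real_distribution (distr std_normal_distribution borel uminus)"
    by (rule std_normal.real_distribution_distr) simp
  show "real_distribution std_normal_distribution" by (rule std_normal.real_distribution_axioms)
  show "char (distr std_normal_distribution borel uminus) = char std_normal_distribution"
  proof
    fix t
    have "char (distr std_normal_distribution borel uminus) t = char std_normal_distribution (- t)"
      unfolding char_def by (subst integral_distr) auto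
    also have "\<dots> = char std_normal_distribution t"
      by (simp add: char_std_normal_distribution)
    finally show "char (distr std_normal_distribution borel uminus) t = char std_normal_distribution t" .
  qed
qed

lemma cdf_uminus_std_normal: "cdf std_normal_distribution (- x) = 1 - cdf std_normal_distribution x"
proof -
  have "cdf std_normal_distribution (- x) = measure (distr std_normal_distribution borel uminus) {..- x}"
    by (simp add: cdf_def2 distr_uminus_std_normal)
  also have "\<dots> = measure std_normal_distribution {x..}"
    by (subst measure_distr) (auto intro!: arg_cong[where f="measure std_normal_distribution"])
  also have "\<dots> = measure std_normal_distribution (space std_normal_distribution - {..<x})"
    by (intro arg_cong[where f="measure std_normal_distribution"]) auto
  also have "\<dots> = 1 - measure std_normal_distribution {..<x}"
    by (subst std_normal.prob_compl) auto
  also have "measure std_normal_distribution {..<x} = measure std_normal_distribution {..x}"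
  proof -
    have "measure std_normal_distribution ({..<x} \<union> {x}) = measure std_normal_distribution {..<x} + measure std_normal_distribution {x}"
      by (rule std_normal.finite_measure_Union) auto
    then show ?thesis by (simp add: measure_std_normal_singleton ivl_disj_un_singleton(2) del: Un_insert_right)
  qed
  finally show ?thesis by (simp add: cdf_def2)
qed

lemma measure_std_normal_symmetric_interval:
  assumes "t \<ge> 0"
  shows "measure std_normal_distribution {- t..t} = 2 * cdf std_normal_distribution t - 1"
proof -
  have "measure std_normal_distribution ({- t} \<union> {- t<..t}) = measure std_normal_distribution {- t} + measure std_normal_distribution {- t<..t}"
    by (rule std_normal.finite_measure_Union) auto
  moreover have "{- t} \<union> {- t<..t} = {- t..t}" using assms by auto
  moreover have "measure std_normal_distribution {- t<..t} = cdf std_normal_distribution t - cdf std_normal_distribution (- t)"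
    using assms std_normal.cdf_diff_eq[of "- t" t] by (cases "t = 0") auto
  ultimately show ?thesis
    by (simp add: measure_std_normal_singleton cdf_uminus_std_normal)
qed

text \<open>Continuity of the distribution function is used twice: the set under the infimum is
  closed, so the infimum belongs to it, and the intermediate value theorem puts into it a point
  where the value u is attained exactly.\<close>

lemma cdf_quantile_std_normal:
  assumes u: "0 < u" "u < 1"
  shows "cdf std_normal_distribution (quantile std_normal_distribution u) = u"
proof -
  define T where "T = {x. u \<le> cdf std_normal_distribution x}"
  obtain b where b: "cdf std_normal_distribution b > u"
    using order_tendstoD(1)[OF std_normal.cdf_lim_at_top_prob u(2)] by (auto simp: eventually_at_top_linorder)
  obtain c where c: "cdf std_normal_distribution c < u"
    using order_tendstoD(2)[OF std_normal.cdf_lim_at_bot u(1)] by (auto simp: eventually_at_bot_linorder)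
  have cb: "c \<le> b"
    using b c std_normal.cdf_nondecreasing[of b c] by (cases "c \<le> b") auto
  obtain x where x: "cdf std_normal_distribution x = u"
    using IVT[of "cdf std_normal_distribution" c u b] b c cb isCont_cdf_std_normal by auto
  have "closed T"
    unfolding T_def
    by (intro closed_Collect_le continuous_on_const continuous_at_imp_continuous_on ballI isCont_cdf_std_normal)
  moreover have "bdd_below T"
  proof (rule bdd_belowI[of _ c])
    fix y assume "y \<in> T"
    then show "c \<le> y"
      using c std_normal.cdf_nondecreasing[of y c] by (cases "c \<le> y") (auto simp: T_def)
  qed
  moreover have xT: "x \<in> T" using x by (simp add: T_def)
  ultimately have "Inf T \<in> T"
    by (intro closed_contains_Inf) auto
  moreover have "cdf std_normal_distribution (Inf T) \<le> u"
    using cInf_lower[OF xT \<open>bdd_below T\<close>] std_normal.cdf_nondecreasing x by metis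
  ultimately show ?thesis
    by (simp add: quantile_def T_def[symmetric]) (simp add: T_def)
qed

lemma std_normal_quantile_interval:
  assumes "0 < \<alpha>" "\<alpha> < 1"
  shows "quantile std_normal_distribution (1 - \<alpha> / 2) > 0"
    and "measure std_normal_distribution {- quantile std_normal_distribution (1 - \<alpha> / 2)..quantile std_normal_distribution (1 - \<alpha> / 2)} = 1 - \<alpha>"
proof -
  have c: "cdf std_normal_distribution (quantile std_normal_distribution (1 - \<alpha> / 2)) = 1 - \<alpha> / 2"
    by (rule cdf_quantile_std_normal) (use assms in auto)
  have "cdf std_normal_distribution 0 = 1 / 2"
    using cdf_uminus_std_normal[of 0] by simp
  then show pos: "quantile std_normal_distribution (1 - \<alpha> / 2) > 0"
    using c assms std_normal.cdf_nondecreasing[of "quantile std_normal_distribution (1 - \<alpha> / 2)" 0] by (cases "quantile std_normal_distribution (1 - \<alpha> / 2) > 0") auto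
  show "measure std_normal_distribution {- quantile std_normal_distribution (1 - \<alpha> / 2)..quantile std_normal_distribution (1 - \<alpha> / 2)} = 1 - \<alpha>"
    using pos by (simp add: measure_std_normal_symmetric_interval c)
qed

text \<open>This allows the half-width t to be perturbed slightly in the final sandwich argument.
  The closed form holds for nonnegative s only, so it is used in a neighbourhood of the positive
  point t.\<close>

lemma isCont_std_normal_symmetric_interval:
  assumes "t > 0"
  shows "isCont (\<lambda>s. measure std_normal_distribution {- s..s}) t"
proof -
  have "isCont (\<lambda>s. 2 * cdf std_normal_distribution s - 1) t"
    by (intro continuous_intros isCont_cdf_std_normal)
  moreover have ev: "eventually (\<lambda>s. 2 * cdf std_normal_distribution s - 1 = measure std_normal_distribution {- s..s}) (nhds t)"
    using eventually_nhds_in_open[of "{0<..}" t] assms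
    by (auto elim!: eventually_mono simp: measure_std_normal_symmetric_interval)
  ultimately show ?thesis
    using isCont_cong[OF ev] by simp
qed

section \<open>Characteristic function estimates\<close>

text \<open>The upper estimate comes from exp(- v) \<le> 1 / (1 + v) and the factorisation (1 - v +
  v^2) (1 + v) = 1 + v^3.\<close>

lemma exp_minus_taylor_bound:
  fixes v :: real
  assumes "v \<ge> 0"
  shows "\<bar>exp (- v) - (1 - v)\<bar> \<le> v\<^sup>2"
proof -
  have "exp (- v) \<le> 1 / (1 + v)"
    using assms exp_ge_add_one_self[of v] by (simp add: exp_minus field_simps)
  also have "\<dots> \<le> 1 - v + v\<^sup>2"
  proof -
    have "1 \<le> 1 + v ^ 3" using assms by simp
    also have "\<dots> = (1 - v + v\<^sup>2) * (1 + v)" by (simp add: power2_eq_square power3_eq_cube algebra_simps)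
    finally show ?thesis using assms by (simp add: pos_divide_le_eq)
  qed
  finally show ?thesis
    using exp_ge_add_one_self[of "- v"] by (simp add: abs_le_iff)
qed

text \<open>With y = a S_n / n, the values 1 - y and - (1 + y), taken with probabilities (1 + y) / 2
  and (1 - y) / 2, form the conditional law of \<open>noise n\<close>. It has mean 0 and variance 1
  - y^2. Comparison with a Gaussian of variance 1 costs u^2 y^2 / 2 for the variance defect and a
  cubic term for the Taylor remainders.\<close>

lemma two_point_char_bound:
  fixes u y :: real
  assumes y: "\<bar>y\<bar> \<le> 1" and u: "\<bar>u\<bar> \<le> 1"
  shows "cmod ((1 + y) / 2 * iexp (u * (1 - y)) + (1 - y) / 2 * iexp (- u * (1 + y)) - exp (- u\<^sup>2 / 2))
    \<le> u\<^sup>2 * y\<^sup>2 / 2 + 2 * \<bar>u\<bar> ^ 3"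
proof -
  define T where "T x = 1 + \<i> * complex_of_real x - (complex_of_real x)\<^sup>2 / 2" for x
  have T: "cmod (iexp x - T x) \<le> \<bar>x\<bar> ^ 3 / 6" for x
    using iexp_approx1[of x 2]
    by (simp add: T_def numeral_3_eq_3 numeral_2_eq_2 fact_numeral power_mult_distrib)
  let ?x1 = "u * (1 - y)" and ?x2 = "- u * (1 + y)"
  let ?p1 = "complex_of_real ((1 + y) / 2)" and ?p2 = "complex_of_real ((1 - y) / 2)"
  \<comment> \<open>Both arguments are at most 2 |u| in absolute value, so the remainder |x|^3 / 6
    is at most 8/6 |u|^3. Together with the 1/4 from the Gaussian factor this stays below the
    constant 2.\<close>
  have small: "cmod (iexp x - T x) \<le> 4 / 3 * \<bar>u\<bar> ^ 3" if "\<bar>x\<bar> \<le> 2 * \<bar>u\<bar>" for x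
  proof -
    have "\<bar>x\<bar> ^ 3 \<le> (2 * \<bar>u\<bar>) ^ 3" using that by (intro power_mono) auto
    with T[of x] show ?thesis by (simp add: power_mult_distrib)
  qed
  have x1: "\<bar>?x1\<bar> \<le> 2 * \<bar>u\<bar>" and x2: "\<bar>?x2\<bar> \<le> 2 * \<bar>u\<bar>"
    using y by (auto simp: abs_mult mult.commute[of 2] intro!: mult_left_mono)
  have e1: "cmod (?p1 * (iexp ?x1 - T ?x1)) \<le> (1 + y) / 2 * (4 / 3 * \<bar>u\<bar> ^ 3)"
    unfolding norm_mult using y small[OF x1] by (intro mult_mono) (auto simp del: of_real_divide)
  have e2: "cmod (?p2 * (iexp ?x2 - T ?x2)) \<le> (1 - y) / 2 * (4 / 3 * \<bar>u\<bar> ^ 3)"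
    unfolding norm_mult using y small[OF x2] by (intro mult_mono) (auto simp del: of_real_divide)
  \<comment> \<open>The linear terms cancel because the two-point law is centred.\<close>
  have poly: "?p1 * T ?x1 + ?p2 * T ?x2 = complex_of_real (1 - u\<^sup>2 / 2 + u\<^sup>2 * y\<^sup>2 / 2)"
    by (simp add: T_def power2_eq_square field_simps)
  have "\<bar>exp (- (u\<^sup>2 / 2)) - (1 - u\<^sup>2 / 2)\<bar> \<le> (u\<^sup>2 / 2)\<^sup>2"
    by (rule exp_minus_taylor_bound) simp
  also have "\<dots> = \<bar>u\<bar> ^ 3 * \<bar>u\<bar> / 4"
    by (simp add: power_divide power2_eq_square power3_eq_cube flip: abs_mult)
  also have "\<dots> \<le> \<bar>u\<bar> ^ 3 * 1 / 4"
    using u by (intro divide_right_mono mult_left_mono) auto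
  finally have e3: "\<bar>exp (- (u\<^sup>2 / 2)) - (1 - u\<^sup>2 / 2)\<bar> \<le> \<bar>u\<bar> ^ 3 / 4" by simp
  have e3': "cmod (complex_of_real (1 - u\<^sup>2 / 2 + u\<^sup>2 * y\<^sup>2 / 2) - complex_of_real (exp (- (u\<^sup>2 / 2)))) \<le> u\<^sup>2 * y\<^sup>2 / 2 + \<bar>u\<bar> ^ 3 / 4"
  proof -
    have "u\<^sup>2 * y\<^sup>2 / 2 \<ge> 0" by simp
    then have "\<bar>1 - u\<^sup>2 / 2 + u\<^sup>2 * y\<^sup>2 / 2 - exp (- (u\<^sup>2 / 2))\<bar> \<le> u\<^sup>2 * y\<^sup>2 / 2 + \<bar>u\<bar> ^ 3 / 4"
      using e3 by linarith
    then show ?thesis by (simp only: of_real_diff[symmetric] norm_of_real)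
  qed
  have "?p1 * iexp ?x1 + ?p2 * iexp ?x2 - complex_of_real (exp (- (u\<^sup>2 / 2))) =
      ?p1 * (iexp ?x1 - T ?x1) + ?p2 * (iexp ?x2 - T ?x2) + (complex_of_real (1 - u\<^sup>2 / 2 + u\<^sup>2 * y\<^sup>2 / 2) - complex_of_real (exp (- (u\<^sup>2 / 2))))"
    unfolding poly[symmetric] by (simp only: right_diff_distrib) simp
  then have "cmod (?p1 * iexp ?x1 + ?p2 * iexp ?x2 - complex_of_real (exp (- (u\<^sup>2 / 2))))
      \<le> (1 + y) / 2 * (4 / 3 * \<bar>u\<bar> ^ 3) + (1 - y) / 2 * (4 / 3 * \<bar>u\<bar> ^ 3) + (u\<^sup>2 * y\<^sup>2 / 2 + \<bar>u\<bar> ^ 3 / 4)"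
    by (simp only:) (intro norm_triangle_le add_mono e1 e2 e3')
  moreover have "(1 + y) / 2 * (4 / 3 * c) + (1 - y) / 2 * (4 / 3 * c) + (d + c / 4) = d + (4 / 3 + 1 / 4) * c" for c d :: real
    by (simp add: field_simps)
  moreover have "u\<^sup>2 * y\<^sup>2 / 2 + (4 / 3 + 1 / 4) * \<bar>u\<bar> ^ 3 \<le> u\<^sup>2 * y\<^sup>2 / 2 + 2 * \<bar>u\<bar> ^ 3"
    by (intro add_left_mono mult_right_mono) auto
  ultimately have "cmod (?p1 * iexp ?x1 + ?p2 * iexp ?x2 - complex_of_real (exp (- (u\<^sup>2 / 2))))
      \<le> u\<^sup>2 * y\<^sup>2 / 2 + 2 * \<bar>u\<bar> ^ 3"
    by (simp only:)
  then show ?thesis by simp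
qed

lemma cmod_iexp_diff_le: "cmod (iexp x - iexp y) \<le> \<bar>x - y\<bar>"
proof -
  have "iexp x - iexp y = iexp y * (iexp (x - y) - 1)"
    by (simp add: right_diff_distrib exp_add[symmetric] algebra_simps)
  then have "cmod (iexp x - iexp y) = cmod (iexp (x - y) - 1)"
    by (simp add: norm_mult)
  also have "\<dots> \<le> \<bar>x - y\<bar>"
    using iexp_approx1[of "x - y" 0] by simp
  finally show ?thesis .
qed

lemma (in prob_space) norm_expectation_le_const:
  fixes f :: "'a \<Rightarrow> 'b :: {banach, second_countable_topology}"
  assumes "AE x in M. norm (f x) \<le> C" "C \<ge> 0"
  shows "norm (LINT x|M. f x) \<le> C"
proof -
  have "norm (LINT x|M. f x) \<le> (LINT x|M. C)"
    by (rule integral_norm_bound[THEN order_trans], rule integral_mono_AE') (use assms in auto)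
  then show ?thesis by (simp add: prob_space)
qed

lemma (in finite_measure) integrable_square_of_bounded:
  fixes f :: "'a \<Rightarrow> real"
  assumes "f \<in> borel_measurable M" "AE x in M. \<bar>f x\<bar> \<le> B"
  shows "integrable M (\<lambda>x. (f x)\<^sup>2)"
proof (rule integrable_const_bound[where B="B\<^sup>2"])
  show "AE x in M. norm ((f x)\<^sup>2) \<le> B\<^sup>2"
    using assms(2) by eventually_elim (simp add: abs_le_square_iff[symmetric])
qed (use assms in auto)

section \<open>The elephant random walk and its martingale differences\<close>

context elephant_random_walk
begin

abbreviation S :: "nat \<Rightarrow> 'a \<Rightarrow> real" where
  "S \<equiv> position X"

abbreviation a :: real where
  "a \<equiv> 2 * p - 1"

text \<open>The natural filtration, written literally as in the assumption \<open>indep_past\<close>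
  so that the latter can be folded into statements about \<open>past n\<close>.\<close>

definition past :: "nat \<Rightarrow> 'a measure" where
  "past n = vimage_algebra (space M) (\<lambda>w. \<lambda>i\<in>{1..n}. X i w) (Pi\<^sub>M {1..n} (\<lambda>_. borel))"

text \<open>The index is the time before the step: \<open>noise n\<close> is measurable for
  \<open>past (Suc n)\<close> and has zero mean against bounded functions of
  \<open>past n\<close>.\<close>

definition noise :: "nat \<Rightarrow> 'a \<Rightarrow> real" where
  "noise n w = X (Suc n) w - a * (S n w / real n)"

lemma space_past [simp]: "space (past n) = space M"
  by (simp add: past_def)

lemma X_past: "1 \<le> k \<Longrightarrow> k \<le> n \<Longrightarrow> X k \<in> borel_measurable (past n)"
proof -
  assume k: "1 \<le> k" "k \<le> n"
  have "(\<lambda>w. \<lambda>i\<in>{1..n}. X i w) \<in> past n \<rightarrow>\<^sub>M Pi\<^sub>M {1..n} (\<lambda>_. borel :: real measure)"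
    unfolding past_def by (intro measurable_vimage_algebra1) (auto simp: space_PiM)
  then have "(\<lambda>w. (\<lambda>i\<in>{1..n}. X i w) k) \<in> borel_measurable (past n)"
    by (rule measurable_compose) (rule measurable_component_singleton, use k in auto)
  then show ?thesis using k by (simp add: restrict_def)
qed

lemma subalgebra_past: "n \<le> m \<Longrightarrow> subalgebra (past m) (past n)"
proof -
  assume "n \<le> m"
  then have "(\<lambda>w. \<lambda>i\<in>{1..n}. X i w) \<in> past m \<rightarrow>\<^sub>M Pi\<^sub>M {1..n} (\<lambda>_. borel)"
    by (intro measurable_restrict X_past) auto
  then have "sets (past n) \<subseteq> sets (past m)"
    unfolding past_def[of n] by (intro sets_image_in_sets) auto
  then show ?thesis by (simp add: subalgebra_def)
qed

lemma subalgebra_past_M: "subalgebra M (past n)"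
proof -
  have "(\<lambda>w. \<lambda>i\<in>{1..n}. X i w) \<in> M \<rightarrow>\<^sub>M Pi\<^sub>M {1..n} (\<lambda>_. borel)"
    by (intro measurable_restrict X_measurable) auto
  then have "sets (past n) \<subseteq> sets M"
    unfolding past_def by (intro sets_image_in_sets) auto
  then show ?thesis by (simp add: subalgebra_def)
qed

lemmas measurable_past_mono = measurable_from_subalg[OF subalgebra_past]
lemmas measurable_past_M = measurable_from_subalg[OF subalgebra_past_M]

lemma S_past: "k \<le> n \<Longrightarrow> S k \<in> borel_measurable (past n)"
  unfolding position_def by (intro borel_measurable_sum X_past) auto

lemma S_measurable [measurable]: "S n \<in> borel_measurable M"
  by (rule measurable_past_M[OF S_past[OF order_refl]])

lemma noise_past: "n < m \<Longrightarrow> noise n \<in> borel_measurable (past m)"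
  unfolding noise_def
  by (intro borel_measurable_diff borel_measurable_times borel_measurable_divide X_past S_past) auto

lemma noise_measurable [measurable]: "noise n \<in> borel_measurable M"
  by (rule measurable_past_M[OF noise_past[OF lessI]])

section \<open>The law of the next step, tested against bounded functions of the past\<close>

lemma choice_prob:
  assumes "n \<ge> 1" "k \<in> {1..n}"
  shows "\<P>(w in M. (K n w, Z n w) = (k, z)) = (if z then p else 1 - p) / real n"
proof -
  have "\<P>(w in M. (K n w, Z n w) = (k, z)) = measure (distr M (count_space UNIV) (\<lambda>w. (K n w, Z n w))) {(k, z)}"
    using choice_measurable[OF \<open>n \<ge> 1\<close>] by (subst measure_distr) (auto intro!: arg_cong[where f=prob])
  also have "\<dots> = pmf (pair_pmf (pmf_of_set {1..n}) (bernoulli_pmf p)) (k, z)"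
    by (simp add: choice_distr[OF \<open>n \<ge> 1\<close>] measure_pmf_single)
  also have "\<dots> = (if z then p else 1 - p) / real n"
    using assms p_range by (auto simp: pmf_pair)
  finally show ?thesis .
qed

lemma AE_choice_in_range: "n \<ge> 1 \<Longrightarrow> AE w in M. K n w \<in> {1..n}"
proof -
  assume n: "n \<ge> 1"
  have "AE x in distr M (count_space UNIV) (\<lambda>w. (K n w, Z n w)). fst x \<in> {1..n}"
    unfolding choice_distr[OF n] using n by (auto simp: AE_measure_pmf_iff)
  then show ?thesis
    by (subst (asm) AE_distr_iff) (use choice_measurable[OF n] in auto)
qed

text \<open>Strong induction is required because the recalled instant can be any earlier time. In
  the base case the two given probabilities q and 1 - q exhaust the total mass.\<close>

lemma AE_X_values_single: "n \<ge> 1 \<Longrightarrow> AE w in M. X n w = 1 \<or> X n w = -1"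
proof (induction n rule: less_induct)
  case (less n)
  show ?case
  proof (cases "n = 1")
    case True
    have [measurable]: "random_variable borel (X (Suc 0))" by (rule X_measurable) simp
    have "\<P>(w in M. X 1 w = 1 \<or> X 1 w = -1) = \<P>(w in M. X 1 w = 1) + \<P>(w in M. X 1 w = -1)"
      by (subst finite_measure_Union[symmetric]) (auto intro!: arg_cong[where f=prob])
    also have "\<dots> = 1" by (simp only: first_step_plus first_step_minus)
    finally show ?thesis
      using True by (subst (asm) prob_Collect_eq_1) auto
  next
    case False
    then obtain m where m: "n = Suc m" "m \<ge> 1" using less.prems by (cases n) auto
    have "AE w in M. \<forall>k\<in>{1..m}. X k w = 1 \<or> X k w = -1"
      by (intro AE_finite_allI less.IH) (use m in auto)
    with step[OF \<open>m \<ge> 1\<close>] AE_choice_in_range[OF \<open>m \<ge> 1\<close>] show ?thesis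
      unfolding m by eventually_elim auto
  qed
qed

lemma AE_X_values: "AE w in M. \<forall>n\<ge>1. X n w = 1 \<or> X n w = -1"
  using AE_X_values_single by (auto simp: AE_all_countable)

lemma AE_bounds: "AE w in M. \<forall>n\<ge>1. \<bar>X n w\<bar> = 1 \<and> \<bar>S n w\<bar> \<le> real n \<and> \<bar>S n w / real n\<bar> \<le> 1 \<and> \<bar>noise n w\<bar> \<le> 2"
  using AE_X_values
proof eventually_elim
  case (elim w)
  have X: "\<bar>X n w\<bar> = 1" if "n \<ge> 1" for n using elim that by auto
  have S: "\<bar>S n w\<bar> \<le> real n" for n
    unfolding position_def
    by (rule sum_abs[THEN order_trans]) (simp add: X)
  have S': "\<bar>S n w / real n\<bar> \<le> 1" for n
    using S[of n] by (cases "n = 0") (auto simp: abs_divide)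
  have "\<bar>a * (S n w / real n)\<bar> \<le> 1 * 1" for n
    unfolding abs_mult using S' p_range by (intro mult_mono) auto
  then have "\<bar>noise n w\<bar> \<le> 2" for n
    unfolding noise_def using X[of "Suc n"] abs_triangle_ineq4[of "X (Suc n) w" "a * (S n w / real n)"]
    by (smt (verit) le_add1 plus_1_eq_Suc)
  with X S S' show ?case by blast
qed

text \<open>Y and the indicator generate sub-algebras of the two independent families in
  \<open>indep_past\<close>, so the expectation of the product factorises. Complex values are
  allowed because Y will contain exponential factors.\<close>

lemma expectation_choice:
  fixes Y :: "'a \<Rightarrow> complex"
  assumes n: "n \<ge> 1" and Y: "Y \<in> borel_measurable (past n)" and B: "AE w in M. cmod (Y w) \<le> B"
    and k: "k \<in> {1..n}"
  shows "(LINT w|M. Y w * indicator {(k, z)} (K n w, Z n w)) = (if z then p else 1 - p) / real n * (LINT w|M. Y w)"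
proof -
  let ?I = "\<lambda>w. indicator {(k, z)} (K n w, Z n w) :: complex"
  have kz: "(\<lambda>w. (K n w, Z n w)) \<in> vimage_algebra (space M) (\<lambda>w. (K n w, Z n w)) (count_space UNIV) \<rightarrow>\<^sub>M count_space UNIV"
    by (intro measurable_vimage_algebra1) auto
  have I: "?I \<in> borel_measurable (vimage_algebra (space M) (\<lambda>w. (K n w, Z n w)) (count_space UNIV))"
    by (rule measurable_compose[OF kz]) simp
  have YM: "Y \<in> borel_measurable M" by (rule measurable_past_M[OF Y])
  have IM: "?I \<in> borel_measurable M"
    by (rule measurable_compose[OF choice_measurable[OF n]]) simp
  have "indep_var borel Y borel ?I"
    unfolding indep_var_eq
  proof (intro conjI YM IM)
    have "sigma_sets (space M) {Y -` A \<inter> space M |A. A \<in> sets borel} \<subseteq> sets (past n)"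
      using Y sets.sigma_sets_subset[of "{Y -` A \<inter> space M |A. A \<in> sets borel}" "past n"]
      by (auto simp: measurable_def)
    moreover have "sigma_sets (space M) {?I -` A \<inter> space M |A. A \<in> sets borel} \<subseteq>
        sets (vimage_algebra (space M) (\<lambda>w. (K n w, Z n w)) (count_space UNIV))"
      using I sets.sigma_sets_subset[of "{?I -` A \<inter> space M |A. A \<in> sets borel}"
          "vimage_algebra (space M) (\<lambda>w. (K n w, Z n w)) (count_space UNIV)"]
      by (auto simp: measurable_def)
    ultimately show "indep_set (sigma_sets (space M) {Y -` A \<inter> space M |A. A \<in> sets borel})
        (sigma_sets (space M) {?I -` A \<inter> space M |A. A \<in> sets borel})"
      using indep_past[OF n] unfolding indep_sets2_eq past_def[symmetric] by blast
  qed
  then have "(LINT w|M. Y w * ?I w) = (LINT w|M. Y w) * (LINT w|M. ?I w)"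
    using B YM IM
    by (intro indep_var_lebesgue_integral integrable_const_bound[where B=B] integrable_const_bound[where B=1])
      (auto simp: indicator_def)
  also have "(LINT w|M. ?I w) = complex_of_real (\<P>(w in M. (K n w, Z n w) = (k, z)))"
  proof -
    have "(LINT w|M. ?I w) = (LINT w|M. complex_of_real (indicator {w \<in> space M. (K n w, Z n w) = (k, z)} w))"
      by (intro Bochner_Integration.integral_cong) (auto simp: indicator_def)
    moreover have "{w \<in> space M. (K n w, Z n w) = (k, z)} = (\<lambda>w. (K n w, Z n w)) -` {(k, z)} \<inter> space M"
      by auto
    then have "{w \<in> space M. (K n w, Z n w) = (k, z)} \<in> events"
      using measurable_sets[OF choice_measurable[OF n], of "{(k, z)}"] by simp
    ultimately show ?thesis
      by (simp add: integral_complex_of_real)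
  qed
  finally show ?thesis
    using choice_prob[OF n k, of z] by (simp add: mult.commute)
qed

text \<open>The weak form of E[X_(n+1) | F_n] = a S_n / n. Splitting according to the value of the
  choice replaces the random index by a fixed one, and the two signs combine to p - (1 - p) = a,
  divided by n.\<close>

lemma expectation_next_step:
  fixes Y :: "'a \<Rightarrow> complex"
  assumes n: "n \<ge> 1" and Y: "Y \<in> borel_measurable (past n)" and B: "AE w in M. cmod (Y w) \<le> B"
  shows "(LINT w|M. Y w * X (Suc n) w) = (LINT w|M. Y w * (a * (S n w / real n)))"
proof -
  define s where "s z = (if z then 1 else -1 :: real)" for z
  define T where "T k z w = Y w * (s z * X k w) * indicator {(k, z)} (K n w, Z n w)" for k z w
  have YM [measurable]: "Y \<in> borel_measurable M" by (rule measurable_past_M[OF Y])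
  have [measurable]: "(\<lambda>w. indicator {(k, z)} (K n w, Z n w) :: complex) \<in> borel_measurable M" for k z
    by (rule measurable_compose[OF choice_measurable[OF n]]) simp
  have XM [measurable]: "k \<in> {1..n} \<Longrightarrow> X k \<in> borel_measurable M" for k
    by (rule X_measurable) auto
  have bnd: "AE w in M. cmod (Y w * (s z * X k w)) \<le> B" if "k \<in> {1..n}" for k z
    using B AE_bounds by eventually_elim (use that in \<open>auto simp: norm_mult s_def\<close>)
  have bndX: "AE w in M. cmod (Y w * X k w) \<le> B" if "k \<in> {1..n}" for k
    using bnd[OF that, of True] by (simp add: s_def)
  have intX: "integrable M (\<lambda>w. Y w * X k w)" if "k \<in> {1..n}" for k
    using bndX that by (intro integrable_const_bound[where B=B]) auto
  have intT: "integrable M (T k z)" if "k \<in> {1..n}" for k z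
  proof (rule integrable_const_bound)
    show "AE w in M. cmod (T k z w) \<le> B"
      using bnd[OF that, of z]
    proof eventually_elim
      case (elim w)
      have "cmod (T k z w) \<le> cmod (Y w * (s z * X k w)) * 1"
        unfolding T_def norm_mult[of "Y w * (s z * X k w)"]
        by (intro mult_left_mono) (auto simp: indicator_def)
      with elim show ?case by simp
    qed
    show "T k z \<in> borel_measurable M"
      unfolding T_def using that by measurable
  qed
  \<comment> \<open>Almost surely the recalled instant lies in the range of summation, so exactly
    one pair (k, z) has indicator 1.\<close>
  have "AE w in M. Y w * X (Suc n) w = (\<Sum>k=1..n. \<Sum>z\<in>UNIV. T k z w)"
    using step[OF n] AE_choice_in_range[OF n]
  proof eventually_elim
    case (elim w)
    have "(\<Sum>k=1..n. \<Sum>z\<in>UNIV. T k z w) = (\<Sum>k=1..n. if k = K n w then Y w * (s (Z n w) * X k w) else 0)"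
      by (intro sum.cong) (auto simp: T_def UNIV_bool indicator_def)
    also have "\<dots> = Y w * (s (Z n w) * X (K n w) w)"
      using elim by (subst sum.delta) auto
    also have "\<dots> = Y w * X (Suc n) w"
      using elim by (auto simp: s_def)
    finally show ?case by simp
  qed
  then have "(LINT w|M. Y w * X (Suc n) w) = (LINT w|M. (\<Sum>k=1..n. \<Sum>z\<in>UNIV. T k z w))"
    using intT[THEN borel_measurable_integrable] X_measurable[of "Suc n"] by (intro integral_cong_AE) auto
  also have "\<dots> = (\<Sum>k=1..n. \<Sum>z\<in>UNIV. LINT w|M. T k z w)"
    using intT by (subst Bochner_Integration.integral_sum; (intro Bochner_Integration.integrable_sum)?; auto intro!: sum.cong Bochner_Integration.integral_sum simp del: UNIV_bool)
  also have "\<dots> = (\<Sum>k=1..n. \<Sum>z\<in>UNIV. (if z then p else 1 - p) / real n * (s z * (LINT w|M. Y w * X k w)))"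
  proof (intro sum.cong refl)
    fix k z assume k: "k \<in> {1..n}"
    have "(LINT w|M. T k z w) = (if z then p else 1 - p) / real n * (LINT w|M. Y w * (s z * X k w))"
      unfolding T_def
    proof (rule expectation_choice[OF n _ bnd[OF k] k])
      have [measurable]: "Y \<in> borel_measurable (past n)" "X k \<in> borel_measurable (past n)"
        using Y X_past k by auto
      show "(\<lambda>w. Y w * (s z * X k w)) \<in> borel_measurable (past n)"
        by measurable
    qed
    also have "(LINT w|M. Y w * (s z * X k w)) = s z * (LINT w|M. Y w * X k w)"
      by (simp add: mult.left_commute flip: integral_mult_right_zero)
    finally show "(LINT w|M. T k z w) = (if z then p else 1 - p) / real n * (s z * (LINT w|M. Y w * X k w))" .
  qed
  also have "\<dots> = (\<Sum>k=1..n. a / real n * (LINT w|M. Y w * X k w))"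
    using n by (intro sum.cong) (auto simp: UNIV_bool s_def field_simps)
  also have "\<dots> = a / real n * (LINT w|M. (\<Sum>k=1..n. Y w * X k w))"
    using intX by (subst Bochner_Integration.integral_sum) (auto simp: sum_distrib_left)
  also have "\<dots> = (LINT w|M. a / real n * (\<Sum>k=1..n. Y w * X k w))"
    by simp
  also have "\<dots> = (LINT w|M. Y w * (a * (S n w / real n)))"
    by (intro Bochner_Integration.integral_cong) (auto simp: position_def sum_distrib_left sum_divide_distrib mult_ac)
  finally show ?thesis .
qed

lemma AE_abs_noise_le: "n \<ge> 1 \<Longrightarrow> AE w in M. \<bar>noise n w\<bar> \<le> 2"
  using AE_bounds by eventually_elim auto

lemma AE_abs_S_div_le: "n \<ge> 1 \<Longrightarrow> AE w in M. \<bar>S n w / real n\<bar> \<le> 1"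
  using AE_bounds by eventually_elim auto

text \<open>The martingale difference property in weak form: the boundedness of Y makes both parts
  of the noise integrable, and the complex identity is read back on the reals.\<close>

lemma expectation_mult_noise:
  fixes Y :: "'a \<Rightarrow> real"
  assumes n: "n \<ge> 1" and Y: "Y \<in> borel_measurable (past n)" and B: "AE w in M. \<bar>Y w\<bar> \<le> B"
  shows "(LINT w|M. Y w * noise n w) = 0"
proof -
  have [measurable]: "Y \<in> borel_measurable M" by (rule measurable_past_M[OF Y])
  have [measurable]: "X (Suc n) \<in> borel_measurable M" by (rule X_measurable) simp
  have [measurable]: "Y \<in> borel_measurable (past n)" by fact
  have bX: "AE w in M. \<bar>Y w * X (Suc n) w\<bar> \<le> B"
    using B AE_bounds by eventually_elim (auto simp: abs_mult)
  have bS: "AE w in M. \<bar>Y w * (a * (S n w / real n))\<bar> \<le> B * (1 * 1)"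
    using B AE_abs_S_div_le[OF n]
  proof eventually_elim
    case (elim w)
    show ?case
      unfolding abs_mult using elim p_range by (intro mult_mono) auto
  qed
  have "(LINT w|M. complex_of_real (Y w) * X (Suc n) w) = (LINT w|M. complex_of_real (Y w) * (a * (S n w / real n)))"
    using n B by (intro expectation_next_step[where B=B]) auto
  then have "(LINT w|M. complex_of_real (Y w * X (Suc n) w)) = (LINT w|M. complex_of_real (Y w * (a * (S n w / real n))))"
    by simp
  then have eq: "(LINT w|M. Y w * X (Suc n) w) = (LINT w|M. Y w * (a * (S n w / real n)))"
    unfolding integral_complex_of_real of_real_eq_iff .
  have "(LINT w|M. Y w * noise n w) = (LINT w|M. Y w * X (Suc n) w - Y w * (a * (S n w / real n)))"
    by (simp add: noise_def right_diff_distrib)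
  also have "\<dots> = 0"
    using bX bS eq
    by (subst Bochner_Integration.integral_diff) (auto intro!: integrable_const_bound)
  finally show ?thesis .
qed

section \<open>Second moments of sums with predictable coefficients\<close>

lemma AE_abs_noise_sum_le:
  assumes "m \<ge> 1" "\<And>j. j \<ge> m \<Longrightarrow> AE w in M. \<bar>H j w\<bar> \<le> B j"
  shows "AE w in M. \<bar>\<Sum>j=m..<n. H j w * noise j w\<bar> \<le> (\<Sum>j=m..<n. B j * 2)"
proof -
  have "AE w in M. \<forall>j\<in>{m..<n}. \<bar>H j w\<bar> \<le> B j"
    using assms by (intro AE_finite_allI) auto
  then show ?thesis using AE_bounds
  proof eventually_elim
    case (elim w)
    show ?case
    proof (rule sum_abs[THEN order_trans], rule sum_mono)
      fix j assume j: "j \<in> {m..<n}"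
      have "\<bar>H j w\<bar> \<le> B j" "\<bar>noise j w\<bar> \<le> 2" using elim j assms(1) by auto
      then show "\<bar>H j w * noise j w\<bar> \<le> B j * 2"
        unfolding abs_mult by (intro mult_mono) auto
    qed
  qed
qed

lemma noise_sum_past:
  assumes "\<And>j. j \<ge> m \<Longrightarrow> H j \<in> borel_measurable (past j)"
  shows "(\<lambda>w. \<Sum>j=m..<n. H j w * noise j w) \<in> borel_measurable (past n)"
proof (intro borel_measurable_sum borel_measurable_times)
  fix j assume j: "j \<in> {m..<n}"
  show "H j \<in> borel_measurable (past n)"
    by (rule measurable_past_mono[OF _ assms]) (use j in auto)
  show "noise j \<in> borel_measurable (past n)"
    by (rule noise_past) (use j in auto)
qed

lemma expectation_noise_sum_sq_Suc:
  fixes P H :: "'a \<Rightarrow> real"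
  assumes n: "n \<ge> 1"
    and P: "P \<in> borel_measurable (past n)" "AE w in M. \<bar>P w\<bar> \<le> C"
    and H: "H \<in> borel_measurable (past n)" "AE w in M. \<bar>H w\<bar> \<le> B"
  shows "(LINT w|M. (P w + H w * noise n w)\<^sup>2) = (LINT w|M. (P w)\<^sup>2) + (LINT w|M. (H w * noise n w)\<^sup>2)"
    and "(LINT w|M. (H w * noise n w)\<^sup>2) \<le> 4 * (LINT w|M. (H w)\<^sup>2)"
proof -
  have [measurable]: "P \<in> borel_measurable M" "H \<in> borel_measurable M"
    using P H measurable_past_M by auto
  have PH: "(\<lambda>w. 2 * P w * H w) \<in> borel_measurable (past n)"
    using P H by auto
  have bPH: "AE w in M. \<bar>2 * P w * H w\<bar> \<le> 2 * C * B"
    using P(2) H(2) by eventually_elim (auto simp: abs_mult intro!: mult_mono)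
  have bPHN: "AE w in M. \<bar>2 * P w * H w * noise n w\<bar> \<le> 2 * C * B * 2"
    using bPH AE_abs_noise_le[OF n]
  proof eventually_elim
    case (elim w)
    show ?case
      unfolding abs_mult[of "2 * P w * H w"]
      using elim order_trans[OF abs_ge_zero elim(1)] by (intro mult_mono) auto
  qed
  have bHN: "AE w in M. \<bar>H w * noise n w\<bar> \<le> B * 2"
    using H(2) AE_abs_noise_le[OF n] by eventually_elim (auto simp: abs_mult intro!: mult_mono)
  have iP: "integrable M (\<lambda>w. (P w)\<^sup>2)" and iH: "integrable M (\<lambda>w. (H w)\<^sup>2)"
    and iHN: "integrable M (\<lambda>w. (H w * noise n w)\<^sup>2)"
    using P(2) H(2) bHN by (auto intro!: integrable_square_of_bounded)
  have iPHN: "integrable M (\<lambda>w. 2 * P w * H w * noise n w)"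
    using bPHN by (auto intro!: integrable_const_bound)
  have "(LINT w|M. (P w + H w * noise n w)\<^sup>2) = (LINT w|M. ((P w)\<^sup>2 + (H w * noise n w)\<^sup>2) + 2 * P w * H w * noise n w)"
    by (intro Bochner_Integration.integral_cong) (auto simp: power2_sum)
  also have "\<dots> = (LINT w|M. (P w)\<^sup>2) + (LINT w|M. (H w * noise n w)\<^sup>2) + (LINT w|M. 2 * P w * H w * noise n w)"
    using iP iHN iPHN by simp
  \<comment> \<open>Orthogonality: everything in front of the noise is known at time n.\<close>
  also have "(LINT w|M. 2 * P w * H w * noise n w) = 0"
    by (rule expectation_mult_noise[OF n PH bPH])
  finally show "(LINT w|M. (P w + H w * noise n w)\<^sup>2) = (LINT w|M. (P w)\<^sup>2) + (LINT w|M. (H w * noise n w)\<^sup>2)"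
    by simp
  have "(LINT w|M. (H w * noise n w)\<^sup>2) \<le> (LINT w|M. 4 * (H w)\<^sup>2)"
  proof (rule integral_mono_AE)
    show "AE w in M. (H w * noise n w)\<^sup>2 \<le> 4 * (H w)\<^sup>2"
      using AE_abs_noise_le[OF n]
    proof eventually_elim
      case (elim w)
      have "(noise n w)\<^sup>2 \<le> 2\<^sup>2" using elim by (metis abs_le_square_iff abs_numeral)
      then have "(H w)\<^sup>2 * (noise n w)\<^sup>2 \<le> (H w)\<^sup>2 * 4" by (intro mult_left_mono) auto
      then show ?case by (simp add: power_mult_distrib mult.commute)
    qed
  qed (use iHN iH in auto)
  then show "(LINT w|M. (H w * noise n w)\<^sup>2) \<le> 4 * (LINT w|M. (H w)\<^sup>2)" by simp
qed

text \<open>The mean-square bound for a discrete stochastic integral: increments are orthogonal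
  because the coefficients are predictable, and 4 bounds the square of the noise. The bounds
  \<open>B j\<close> ensure integrability and do not enter the estimate.\<close>

lemma expectation_noise_sum_sq_le:
  assumes m: "m \<ge> 1"
    and H: "\<And>j. j \<ge> m \<Longrightarrow> H j \<in> borel_measurable (past j)"
    and B: "\<And>j. j \<ge> m \<Longrightarrow> AE w in M. \<bar>H j w\<bar> \<le> B j"
  shows "(LINT w|M. (\<Sum>j=m..<n. H j w * noise j w)\<^sup>2) \<le> 4 * (\<Sum>j=m..<n. LINT w|M. (H j w)\<^sup>2)"
proof (induction n)
  case (Suc n)
  show ?case
  proof (cases "m \<le> n")
    case True
    let ?P = "\<lambda>w. \<Sum>j=m..<n. H j w * noise j w"
    have "(LINT w|M. (?P w + H n w * noise n w)\<^sup>2) = (LINT w|M. (?P w)\<^sup>2) + (LINT w|M. (H n w * noise n w)\<^sup>2)"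
      "(LINT w|M. (H n w * noise n w)\<^sup>2) \<le> 4 * (LINT w|M. (H n w)\<^sup>2)"
      using expectation_noise_sum_sq_Suc[OF _ noise_sum_past[OF H] AE_abs_noise_sum_le[OF m B] H[OF True] B[OF True]]
        True m by auto
    then show ?thesis using Suc True by (simp add: distrib_left)
  qed simp
qed simp

section \<open>The normalised walk and characteristic functions of noise sums\<close>

definition mart :: "nat \<Rightarrow> 'a \<Rightarrow> real" where
  "mart n w = S n w / growth a n"

lemma mart_past: "k \<le> n \<Longrightarrow> mart k \<in> borel_measurable (past n)"
  unfolding mart_def by (intro borel_measurable_divide S_past) auto

lemma mart_measurable [measurable]: "mart n \<in> borel_measurable M"
  unfolding mart_def by measurable

text \<open>As the next step is 1 or -1, the factors (1 + X) / 2 and (1 - X) / 2 are indicators of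
  its two values. The exponential thus becomes affine in \<open>X (Suc n)\<close> with coefficients
  known at time n, so that \<open>expectation_next_step\<close> applies to it.\<close>

lemma AE_iexp_noise:
  assumes "n \<ge> 1"
  shows "AE w in M. iexp (u * noise n w) =
    (1 + X (Suc n) w) / 2 * iexp (u * (1 - a * (S n w / real n))) +
    (1 - X (Suc n) w) / 2 * iexp (- u * (1 + a * (S n w / real n)))"
  using AE_X_values
proof eventually_elim
  case (elim w)
  define y where "y = a * (S n w / real n)"
  have "(X (Suc n) w = 1 \<and> noise n w = 1 - y) \<or> (X (Suc n) w = -1 \<and> noise n w = - 1 - y)"
    using elim by (auto simp: noise_def y_def)
  then show ?case
    unfolding y_def[symmetric] by (elim disjE conjE) (simp_all add: ring_distribs)
qed

text \<open>Under the expectation the next step may be replaced by y = a S_n / n in the affine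
  expression above; what remains is the two-point characteristic function, estimated pointwise. The
  random variance 1 - y^2 is thereby traded for the constant 1, at a price controlled by the second
  moment of S_n / n.\<close>

lemma expectation_iexp_noise_bound:
  fixes Y :: "'a \<Rightarrow> complex"
  assumes n: "n \<ge> 1" and Y [measurable]: "Y \<in> borel_measurable (past n)"
    and B: "AE w in M. cmod (Y w) \<le> B" and u: "\<bar>u\<bar> \<le> 1"
  shows "cmod ((LINT w|M. Y w * iexp (u * noise n w)) - (LINT w|M. Y w) * exp (- u\<^sup>2 / 2))
    \<le> B * (u\<^sup>2 * (LINT w|M. (S n w / real n)\<^sup>2) / 2 + 2 * \<bar>u\<bar> ^ 3)"
proof -
  define y where "y w = a * (S n w / real n)" for w
  define E1 where "E1 w = iexp (u * (1 - y w))" for w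
  define E2 where "E2 w = iexp (- u * (1 + y w))" for w
  have [measurable]: "y \<in> borel_measurable (past n)"
    unfolding y_def using S_past[of n n] by measurable
  have [measurable]: "E1 \<in> borel_measurable (past n)" "E2 \<in> borel_measurable (past n)"
    unfolding E1_def E2_def by measurable
  have [measurable]: "E1 \<in> borel_measurable M" "E2 \<in> borel_measurable M" "Y \<in> borel_measurable M" "y \<in> borel_measurable M"
    by (rule measurable_past_M[of _ n], measurable)+
  have [measurable]: "X (Suc n) \<in> borel_measurable M" by (rule X_measurable) simp
  have [simp]: "cmod (E1 w) = 1" "cmod (E2 w) = 1" for w by (simp_all add: E1_def E2_def)
  have B0: "B \<ge> 0"
  proof -
    have "AE w in M. 0 \<le> B" using B by eventually_elim (use norm_ge_zero order_trans in blast)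
    then show ?thesis by simp
  qed
  have yb: "AE w in M. \<bar>y w\<bar> \<le> \<bar>S n w / real n\<bar>"
  proof (rule AE_I2)
    fix w
    have "\<bar>a\<bar> \<le> 1" using p_range by auto
    then have "\<bar>a\<bar> * \<bar>S n w / real n\<bar> \<le> 1 * \<bar>S n w / real n\<bar>" by (intro mult_right_mono) auto
    then show "\<bar>y w\<bar> \<le> \<bar>S n w / real n\<bar>" by (simp only: y_def abs_mult mult_1)
  qed
  have int: "integrable M f" if "f \<in> borel_measurable M" "AE w in M. cmod (f w) \<le> B * 1" for f :: "'a \<Rightarrow> complex"
    using that by (intro integrable_const_bound[where B="B * 1"])
  have bY: "AE w in M. cmod (Y w * E1 w) \<le> B" "AE w in M. cmod (Y w * E2 w) \<le> B"
    using B by (auto simp: norm_mult)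
  have iX: "integrable M (\<lambda>w. Y w * E1 w * X (Suc n) w)" "integrable M (\<lambda>w. Y w * E2 w * X (Suc n) w)"
  proof -
    have "AE w in M. cmod (Y w * E1 w * X (Suc n) w) \<le> B * 1" "AE w in M. cmod (Y w * E2 w * X (Suc n) w) \<le> B * 1"
      using B AE_bounds by (eventually_elim, auto simp: norm_mult)+
    then show "integrable M (\<lambda>w. Y w * E1 w * X (Suc n) w)" "integrable M (\<lambda>w. Y w * E2 w * X (Suc n) w)"
      by (auto intro!: int)
  qed
  have iy: "integrable M (\<lambda>w. Y w * E1 w * y w)" "integrable M (\<lambda>w. Y w * E2 w * y w)"
  proof -
    have "AE w in M. cmod (Y w) * \<bar>y w\<bar> \<le> B * 1"
      using B yb AE_abs_S_div_le[OF n]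
      by eventually_elim (intro mult_mono, auto simp: B0)
    then have "AE w in M. cmod (Y w * E1 w * y w) \<le> B * 1" "AE w in M. cmod (Y w * E2 w * y w) \<le> B * 1"
      by (simp_all add: norm_mult)
    then show "integrable M (\<lambda>w. Y w * E1 w * y w)" "integrable M (\<lambda>w. Y w * E2 w * y w)"
      by (auto intro!: int)
  qed
  have i1: "integrable M (\<lambda>w. Y w * E1 w)" "integrable M (\<lambda>w. Y w * E2 w)"
    using bY by (auto intro!: int)
  have iY: "integrable M Y"
    using B by (auto intro!: int)
  have e1: "(LINT w|M. Y w * E1 w * X (Suc n) w) = (LINT w|M. Y w * E1 w * y w)"
    unfolding y_def by (rule expectation_next_step[OF n _ bY(1)]) measurable
  have e2: "(LINT w|M. Y w * E2 w * X (Suc n) w) = (LINT w|M. Y w * E2 w * y w)"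
    unfolding y_def by (rule expectation_next_step[OF n _ bY(2)]) measurable
  \<comment> \<open>The integral is affine in \<open>f\<close>. It is used with
    \<open>f = X (Suc n)\<close> and with \<open>f = y\<close>, and \<open>e1\<close> and
    \<open>e2\<close> identify the two results.\<close>
  have split: "(LINT w|M. Y w * ((1 + f w) / 2 * E1 w + (1 - f w) / 2 * E2 w)) =
      ((LINT w|M. Y w * E1 w) + (LINT w|M. Y w * E1 w * f w) + (LINT w|M. Y w * E2 w) - (LINT w|M. Y w * E2 w * f w)) / 2"
    if "integrable M (\<lambda>w. Y w * E1 w * complex_of_real (f w))" "integrable M (\<lambda>w. Y w * E2 w * complex_of_real (f w))" for f :: "'a \<Rightarrow> real"
  proof -
    have "(LINT w|M. Y w * ((1 + f w) / 2 * E1 w + (1 - f w) / 2 * E2 w)) =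
      (LINT w|M. (Y w * E1 w + Y w * E1 w * f w + Y w * E2 w - Y w * E2 w * f w) / 2)"
      by (intro Bochner_Integration.integral_cong) (auto simp: field_simps)
    also have "\<dots> = ((LINT w|M. Y w * E1 w) + (LINT w|M. Y w * E1 w * f w) + (LINT w|M. Y w * E2 w) - (LINT w|M. Y w * E2 w * f w)) / 2"
      using that i1 by simp
    finally show ?thesis .
  qed
  have "(LINT w|M. Y w * iexp (u * noise n w)) =
      (LINT w|M. Y w * ((1 + X (Suc n) w) / 2 * E1 w + (1 - X (Suc n) w) / 2 * E2 w))"
  proof (rule integral_cong_AE)
    show "AE w in M. Y w * iexp (u * noise n w) = Y w * ((1 + X (Suc n) w) / 2 * E1 w + (1 - X (Suc n) w) / 2 * E2 w)"
      using AE_iexp_noise[OF n, of u] by eventually_elim (simp only: E1_def E2_def y_def)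
  qed measurable
  also have "\<dots> = (LINT w|M. Y w * ((1 + y w) / 2 * E1 w + (1 - y w) / 2 * E2 w))"
    by (simp only: split[OF iX] split[OF iy] e1 e2)
  finally have "(LINT w|M. Y w * iexp (u * noise n w)) - (LINT w|M. Y w) * exp (- u\<^sup>2 / 2) =
      (LINT w|M. Y w * ((1 + y w) / 2 * E1 w + (1 - y w) / 2 * E2 w)) - (LINT w|M. Y w * exp (- u\<^sup>2 / 2))"
    by simp
  also have "\<dots> = (LINT w|M. Y w * ((1 + y w) / 2 * E1 w + (1 - y w) / 2 * E2 w) - Y w * exp (- u\<^sup>2 / 2))"
  proof (rule Bochner_Integration.integral_diff[symmetric])
    have "integrable M (\<lambda>w. (Y w * E1 w + Y w * E1 w * y w + Y w * E2 w - Y w * E2 w * y w) / 2)"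
      using iy i1 by simp
    then show "integrable M (\<lambda>w. Y w * ((1 + y w) / 2 * E1 w + (1 - y w) / 2 * E2 w))"
      by (rule Bochner_Integration.integrable_cong[THEN iffD1, rotated 2]) (auto simp: field_simps)
  qed (use iY in simp)
  finally have "cmod ((LINT w|M. Y w * iexp (u * noise n w)) - (LINT w|M. Y w) * exp (- u\<^sup>2 / 2)) =
      cmod (LINT w|M. Y w * ((1 + y w) / 2 * E1 w + (1 - y w) / 2 * E2 w) - Y w * exp (- u\<^sup>2 / 2))"
    by (rule arg_cong)
  also have "\<dots> \<le> (LINT w|M. B * (u\<^sup>2 * (S n w / real n)\<^sup>2 / 2 + 2 * \<bar>u\<bar> ^ 3))"
  proof (rule integral_norm_bound[THEN order_trans], rule integral_mono_AE')
    show "integrable M (\<lambda>w. B * (u\<^sup>2 * (S n w / real n)\<^sup>2 / 2 + 2 * \<bar>u\<bar> ^ 3))"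
      using integrable_square_of_bounded[OF _ AE_abs_S_div_le[OF n]] by simp
    show "AE w in M. 0 \<le> B * (u\<^sup>2 * (S n w / real n)\<^sup>2 / 2 + 2 * \<bar>u\<bar> ^ 3)"
      using B0 by (intro AE_I2 mult_nonneg_nonneg add_nonneg_nonneg) auto
    show "AE w in M. cmod (Y w * ((1 + y w) / 2 * E1 w + (1 - y w) / 2 * E2 w) - Y w * exp (- u\<^sup>2 / 2))
        \<le> B * (u\<^sup>2 * (S n w / real n)\<^sup>2 / 2 + 2 * \<bar>u\<bar> ^ 3)"
      using B yb AE_abs_S_div_le[OF n]
    proof eventually_elim
      case (elim w)
      have "cmod (Y w * ((1 + y w) / 2 * E1 w + (1 - y w) / 2 * E2 w) - Y w * exp (- u\<^sup>2 / 2)) =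
          cmod (Y w) * cmod ((1 + y w) / 2 * E1 w + (1 - y w) / 2 * E2 w - exp (- u\<^sup>2 / 2))"
        by (simp only: norm_mult[symmetric] right_diff_distrib)
      also have "\<dots> \<le> B * (u\<^sup>2 * (y w)\<^sup>2 / 2 + 2 * \<bar>u\<bar> ^ 3)"
        unfolding E1_def E2_def using elim u by (intro mult_mono two_point_char_bound B0) auto
      also have "\<dots> \<le> B * (u\<^sup>2 * (S n w / real n)\<^sup>2 / 2 + 2 * \<bar>u\<bar> ^ 3)"
        using elim abs_le_square_iff[of "y w" "S n w / real n"]
        by (intro mult_left_mono add_right_mono divide_right_mono B0) auto
      finally show ?case .
    qed
  qed
  also have "\<dots> = B * (u\<^sup>2 * (LINT w|M. (S n w / real n)\<^sup>2) / 2 + 2 * \<bar>u\<bar> ^ 3)"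
  proof -
    define f where "f w = (S n w / real n)\<^sup>2" for w
    have "integrable M f"
      unfolding f_def[abs_def]
    proof (rule integrable_square_of_bounded)
      show "AE w in M. \<bar>S n w / real n\<bar> \<le> 1" by (rule AE_abs_S_div_le[OF n])
    qed measurable
    then have "(LINT w|M. B * (u\<^sup>2 * f w / 2 + 2 * \<bar>u\<bar> ^ 3)) = B * (u\<^sup>2 * (LINT w|M. f w) / 2 + 2 * \<bar>u\<bar> ^ 3)"
      by (simp add: prob_space)
    then show ?thesis by (simp only: f_def)
  qed
  finally show ?thesis .
qed

text \<open>Induction removes the last step: Y times the exponential of the earlier noise is again
  bounded by B and known at time n, so it plays the role of Y in the one-step estimate. The errors
  simply add.\<close>

lemma char_noise_sum_bound:
  fixes Y :: "'a \<Rightarrow> complex" and b :: "nat \<Rightarrow> real"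
  assumes m: "m \<ge> 1" and Y: "Y \<in> borel_measurable (past m)"
    and B: "AE w in M. cmod (Y w) \<le> B" and b: "\<And>j. j \<in> {m..<n} \<Longrightarrow> \<bar>b j\<bar> \<le> 1" and n: "m \<le> n"
  shows "cmod ((LINT w|M. Y w * iexp (\<Sum>j=m..<n. b j * noise j w)) - (LINT w|M. Y w) * exp (- (\<Sum>j=m..<n. (b j)\<^sup>2) / 2))
    \<le> B * (\<Sum>j=m..<n. (b j)\<^sup>2 * (LINT w|M. (S j w / real j)\<^sup>2) / 2 + 2 * \<bar>b j\<bar> ^ 3)"
  using n b
proof (induction n rule: dec_induct)
  case base
  then show ?case by simp
next
  case (step n)
  let ?P = "\<lambda>w. iexp (\<Sum>j=m..<n. b j * noise j w)"
  let ?q = "complex_of_real (exp (- (b n)\<^sup>2 / 2))"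
  let ?I = "LINT w|M. Y w * ?P w" and ?Y = "LINT w|M. Y w"
  let ?E = "complex_of_real (exp (- (\<Sum>j=m..<n. (b j)\<^sup>2) / 2))"
  have "(\<lambda>w. \<Sum>j=m..<n. b j * noise j w) \<in> borel_measurable (past n)"
    by (rule noise_sum_past) auto
  then have meas: "(\<lambda>w. Y w * ?P w) \<in> borel_measurable (past n)"
    using measurable_past_mono[OF step(1) Y] by measurable
  have 1: "cmod ((LINT w|M. (Y w * ?P w) * iexp (b n * noise n w)) - ?I * ?q)
    \<le> B * ((b n)\<^sup>2 * (LINT w|M. (S n w / real n)\<^sup>2) / 2 + 2 * \<bar>b n\<bar> ^ 3)"
    using m step B by (intro expectation_iexp_noise_bound meas) (auto simp: norm_mult)
  \<comment> \<open>The Gaussian factor is at most 1, so the accumulated error is not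
    magnified.\<close>
  have 2: "cmod ((?I - ?Y * ?E) * ?q) \<le> cmod (?I - ?Y * ?E) * 1"
    unfolding norm_mult by (intro mult_left_mono) auto
  have 3: "cmod (?I - ?Y * ?E) \<le> B * (\<Sum>j=m..<n. (b j)\<^sup>2 * (LINT w|M. (S j w / real j)\<^sup>2) / 2 + 2 * \<bar>b j\<bar> ^ 3)"
    using step by auto
  have "(LINT w|M. Y w * iexp (\<Sum>j=m..<Suc n. b j * noise j w)) = (LINT w|M. (Y w * ?P w) * iexp (b n * noise n w))"
    using step(1) by (simp add: exp_add distrib_left mult_ac)
  moreover have "complex_of_real (exp (- (\<Sum>j=m..<Suc n. (b j)\<^sup>2) / 2)) = ?E * ?q"
  proof -
    have "- (\<Sum>j=m..<Suc n. (b j)\<^sup>2) / 2 = - (\<Sum>j=m..<n. (b j)\<^sup>2) / 2 + - (b n)\<^sup>2 / 2"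
      using step(1) by simp
    then show ?thesis by (simp only: exp_add of_real_mult)
  qed
  ultimately have "cmod ((LINT w|M. Y w * iexp (\<Sum>j=m..<Suc n. b j * noise j w)) - ?Y * exp (- (\<Sum>j=m..<Suc n. (b j)\<^sup>2) / 2)) =
      cmod (((LINT w|M. (Y w * ?P w) * iexp (b n * noise n w)) - ?I * ?q) + (?I - ?Y * ?E) * ?q)"
    by (simp add: algebra_simps)
  also have "\<dots> \<le> B * ((b n)\<^sup>2 * (LINT w|M. (S n w / real n)\<^sup>2) / 2 + 2 * \<bar>b n\<bar> ^ 3) +
      B * (\<Sum>j=m..<n. (b j)\<^sup>2 * (LINT w|M. (S j w / real j)\<^sup>2) / 2 + 2 * \<bar>b j\<bar> ^ 3)"
    using 1 2 3 by (intro norm_triangle_le add_mono) auto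
  also have "\<dots> = B * (\<Sum>j=m..<Suc n. (b j)\<^sup>2 * (LINT w|M. (S j w / real j)\<^sup>2) / 2 + 2 * \<bar>b j\<bar> ^ 3)"
    using step(1) by (simp add: algebra_simps)
  finally show ?case .
qed

end

section \<open>The superdiffusive regime\<close>

locale superdiffusive_erw = elephant_random_walk +
  assumes superdiffusive: "3 / 4 < p" and p_less_1: "p < 1"
begin

lemma a_bounds: "1 / 2 < a" "0 < a" "0 \<le> a" "a < 1" "a \<le> 1"
  using superdiffusive p_less_1 by auto

section \<open>Mean-square bounds for the normalised walk\<close>

lemma mart_Suc:
  assumes "n \<ge> 1"
  shows "mart (Suc n) w = mart n w + 1 / growth a (Suc n) * noise n w"
proof -
  have "S (Suc n) w = S n w + X (Suc n) w" by (simp add: position_def)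
  then have "S (Suc n) w = S n w * (1 + a / real n) + noise n w"
    by (simp add: noise_def algebra_simps)
  moreover have "growth a (Suc n) = growth a n * (1 + a / real n)"
    using assms by (rule growth_Suc)
  moreover have "1 + a / real n > 0"
    using a_bounds assms by (intro add_pos_nonneg) auto
  ultimately show ?thesis
    by (simp add: mart_def add_divide_distrib)
qed

lemma S_div_eq: "n \<ge> 1 \<Longrightarrow> S n w / real n = weight a n * mart n w"
  using growth_pos[OF a_bounds(3), of n] by (simp add: mart_def weight_def)

lemma mart_diff:
  assumes "1 \<le> m" "m \<le> n"
  shows "mart n w - mart m w = (\<Sum>j=m..<n. 1 / growth a (Suc j) * noise j w)"
  using \<open>m \<le> n\<close>
proof (induction n rule: dec_induct)
  case (step n)
  then show ?case using mart_Suc[of n w] assms by simp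
qed simp

lemma AE_abs_mart_le: "AE w in M. \<forall>n\<ge>1. \<bar>mart n w\<bar> \<le> real n"
  using AE_bounds
proof eventually_elim
  case (elim w)
  show ?case
  proof (intro allI impI)
    fix n :: nat assume n: "n \<ge> 1"
    have "\<bar>mart n w\<bar> \<le> real n / 1"
      unfolding mart_def abs_divide using elim n growth_ge_1[OF a_bounds(3), of n]
      by (intro frac_le) auto
    then show "\<bar>mart n w\<bar> \<le> real n" by simp
  qed
qed

text \<open>The remainder of the series of squared increment coefficients from index m on, times the
  bound 4 for the squared noise: a bound, uniform in the later time, for the mean-square distance
  from the martingale at time m.\<close>

definition tail :: "nat \<Rightarrow> real" where
  "tail m = 4 * ((\<Sum>j. 1 / (growth a (Suc j))\<^sup>2) - (\<Sum>j<m. 1 / (growth a (Suc j))\<^sup>2))"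

lemma summable_growth_Suc: "summable (\<lambda>j. 1 / (growth a (Suc j))\<^sup>2)"
  using summable_inverse_growth_sq[OF a_bounds(1)] by (subst summable_Suc_iff)

lemma tail_tendsto_0: "tail \<longlonglongrightarrow> 0"
proof -
  have "(\<lambda>m. 4 * ((\<Sum>j. 1 / (growth a (Suc j))\<^sup>2) - (\<Sum>j<m. 1 / (growth a (Suc j))\<^sup>2))) \<longlonglongrightarrow>
      4 * ((\<Sum>j. 1 / (growth a (Suc j))\<^sup>2) - (\<Sum>j. 1 / (growth a (Suc j))\<^sup>2))"
    by (intro tendsto_intros summable_LIMSEQ summable_growth_Suc)
  then show ?thesis by (simp add: tail_def[abs_def])
qed

lemma expectation_mart_diff_sq_le:
  assumes "1 \<le> m" "m \<le> n"
  shows "(LINT w|M. (mart n w - mart m w)\<^sup>2) \<le> tail m"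
proof -
  let ?f = "\<lambda>j. 1 / (growth a (Suc j))\<^sup>2"
  have "(LINT w|M. (mart n w - mart m w)\<^sup>2) \<le> 4 * (\<Sum>j=m..<n. LINT w|M. (1 / growth a (Suc j))\<^sup>2)"
    unfolding mart_diff[OF assms]
    by (rule expectation_noise_sum_sq_le[OF \<open>1 \<le> m\<close>, where B = "\<lambda>j. \<bar>1 / growth a (Suc j)\<bar>"]) auto
  also have "\<dots> = 4 * (\<Sum>j=m..<n. ?f j)"
    by (simp add: power_divide prob_space)
  also have "(\<Sum>j=m..<n. ?f j) = (\<Sum>j<n. ?f j) - (\<Sum>j<m. ?f j)"
    using assms sum.atLeastLessThan_concat[of 0 m n ?f] by (simp add: atLeast0LessThan)
  also have "4 * \<dots> \<le> tail m"
    unfolding tail_def by (intro mult_left_mono diff_right_mono sum_le_suminf summable_growth_Suc) auto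
  finally show ?thesis by simp
qed

lemma integrable_mart_sq: "n \<ge> 1 \<Longrightarrow> integrable M (\<lambda>w. (mart n w)\<^sup>2)"
  by (rule integrable_square_of_bounded[where B="real n"]) (use AE_abs_mart_le in \<open>auto elim!: eventually_mono\<close>)

lemma AE_abs_mart_diff_le: "1 \<le> m \<Longrightarrow> 1 \<le> n \<Longrightarrow> AE w in M. \<bar>mart n w - mart m w\<bar> \<le> real n + real m"
  using AE_abs_mart_le
proof eventually_elim
  case (elim w)
  then have "\<bar>mart n w\<bar> \<le> real n" "\<bar>mart m w\<bar> \<le> real m" by auto
  then show ?case by linarith
qed

lemma integrable_mart_diff_sq: "1 \<le> m \<Longrightarrow> 1 \<le> n \<Longrightarrow> integrable M (\<lambda>w. (mart n w - mart m w)\<^sup>2)"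
  by (rule integrable_square_of_bounded[OF _ AE_abs_mart_diff_le]) auto

lemma tail_nonneg: "m \<ge> 1 \<Longrightarrow> tail m \<ge> 0"
  using expectation_mart_diff_sq_le[of m m] by simp

lemma expectation_mart_1_sq: "(LINT w|M. (mart 1 w)\<^sup>2) = 1"
proof -
  have "AE w in M. (mart 1 w)\<^sup>2 = 1"
    using AE_X_values by eventually_elim (auto simp: mart_def position_def)
  then have "(LINT w|M. (mart 1 w)\<^sup>2) = (LINT w|M. 1)"
    by (intro integral_cong_AE) auto
  then show ?thesis by (simp add: prob_space)
qed

text \<open>Orthogonal increments make the second moment nondecreasing, and it starts at 1 for every
  q since the first step has square 1. This lower bound is what prevents the limit from vanishing
  almost surely.\<close>

lemma expectation_mart_sq_ge_1:
  assumes "n \<ge> 1"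
  shows "(LINT w|M. (mart n w)\<^sup>2) \<ge> 1"
  using assms
proof (induction n rule: dec_induct)
  case (step n)
  have "(LINT w|M. (mart (Suc n) w)\<^sup>2) = (LINT w|M. (mart n w)\<^sup>2) + (LINT w|M. (1 / growth a (Suc n) * noise n w)\<^sup>2)"
    unfolding mart_Suc[OF step(1)]
    by (rule expectation_noise_sum_sq_Suc[OF step(1) mart_past, where C="real n" and B="\<bar>1 / growth a (Suc n)\<bar>"])
      (use AE_abs_mart_le step(1) in \<open>auto elim!: eventually_mono\<close>)
  moreover have "(LINT w|M. (1 / growth a (Suc n) * noise n w)\<^sup>2) \<ge> 0"
    by (rule integral_nonneg_AE) auto
  ultimately show ?case using step by linarith
qed (use expectation_mart_1_sq in simp)

lemma expectation_mart_sq_le: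
  assumes "n \<ge> 1"
  shows "(LINT w|M. (mart n w)\<^sup>2) \<le> 2 * tail 1 + 2"
proof -
  have "(LINT w|M. (mart n w)\<^sup>2) \<le> (LINT w|M. 2 * (mart n w - mart 1 w)\<^sup>2 + 2 * (mart 1 w)\<^sup>2)"
  proof (rule integral_mono)
    fix w
    \<comment> \<open>With x and y the values at times n and 1, (x - 2 y)^2 is the difference 2 (x -
      y)^2 + 2 y^2 - x^2.\<close>
    have "0 \<le> (mart n w - 2 * mart 1 w)\<^sup>2" by simp
    then show "(mart n w)\<^sup>2 \<le> 2 * (mart n w - mart 1 w)\<^sup>2 + 2 * (mart 1 w)\<^sup>2"
      by (simp add: power2_eq_square algebra_simps)
  qed (use assms integrable_mart_sq integrable_mart_diff_sq in auto)
  also have "\<dots> = 2 * (LINT w|M. (mart n w - mart 1 w)\<^sup>2) + 2 * (LINT w|M. (mart 1 w)\<^sup>2)"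
    using assms integrable_mart_sq integrable_mart_diff_sq by simp
  also have "\<dots> \<le> 2 * tail 1 + 2"
    using expectation_mart_diff_sq_le[of 1 n] assms expectation_mart_1_sq by simp
  finally show ?thesis .
qed

section \<open>Central limit theorem with deterministic weights\<close>

definition clt_scale :: "nat \<Rightarrow> real" where
  "clt_scale n = sqrt (weight_norm_sq a n)"

definition clt_sum :: "nat \<Rightarrow> 'a \<Rightarrow> real" where
  "clt_sum n w = (\<Sum>j=1..<n. weight a j / clt_scale n * noise j w)"

lemma clt_sum_measurable [measurable]: "clt_sum n \<in> borel_measurable M"
  unfolding clt_sum_def by measurable

lemma clt_scale_ge_1: "n \<ge> 2 \<Longrightarrow> clt_scale n \<ge> 1"
  unfolding clt_scale_def using weight_norm_sq_ge_1[OF a_bounds(3)] by simp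

lemma clt_scale_sq: "(clt_scale n)\<^sup>2 = weight_norm_sq a n"
  unfolding clt_scale_def weight_norm_sq_def by (simp add: sum_nonneg)

lemma clt_scale_at_top: "filterlim clt_scale at_top sequentially"
  unfolding clt_scale_def
  by (rule filterlim_compose[OF sqrt_at_top weight_norm_sq_at_top]) (use a_bounds in auto)

lemma const_over_clt_scale_tendsto_0: "(\<lambda>n. c / clt_scale n) \<longlonglongrightarrow> 0"
  by (rule tendsto_divide_0[OF tendsto_const filterlim_at_top_imp_at_infinity[OF clt_scale_at_top]])

lemma abs_weight_le_1: "j \<ge> 1 \<Longrightarrow> \<bar>weight a j\<bar> \<le> 1"
  using weight_pos[OF a_bounds(3), of j] weight_le_1[OF a_bounds(3,5), of j] by simp

text \<open>The conditional variance of step j is 1 - (a S_j / j)^2; since |a| \<le> 1, this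
  weighted mean bounds the expected total defect of the conditional variances of
  \<open>clt_sum n\<close> from 1.\<close>

definition avg_sq :: "nat \<Rightarrow> real" where
  "avg_sq n = (\<Sum>j=1..<n. (weight a j)\<^sup>2 * (LINT w|M. (S j w / real j)\<^sup>2)) / weight_norm_sq a n"

lemma avg_sq_tendsto_0: "avg_sq \<longlonglongrightarrow> 0"
  unfolding avg_sq_def[abs_def] weight_norm_sq_def
proof (rule weighted_average_tendsto)
  show "filterlim (\<lambda>n. \<Sum>k=1..<n. (weight a k)\<^sup>2) at_top sequentially"
    using weight_norm_sq_at_top[of a] a_bounds(1) by (simp add: weight_norm_sq_def[abs_def])
  have "(\<lambda>j. (weight a j)\<^sup>2 * (2 * tail 1 + 2)) \<longlonglongrightarrow> 0\<^sup>2 * (2 * tail 1 + 2)"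
    by (intro tendsto_intros weight_tendsto_0 a_bounds)
  then have lim: "(\<lambda>j. (weight a j)\<^sup>2 * (2 * tail 1 + 2)) \<longlonglongrightarrow> 0" by simp
  show "(\<lambda>j. LINT w|M. (S j w / real j)\<^sup>2) \<longlonglongrightarrow> 0"
  proof (rule tendsto_sandwich[OF _ _ tendsto_const lim])
    show "eventually (\<lambda>j. (LINT w|M. (S j w / real j)\<^sup>2) \<le> (weight a j)\<^sup>2 * (2 * tail 1 + 2)) sequentially"
      using eventually_ge_at_top[of 1]
    proof eventually_elim
      case (elim j)
      have "(LINT w|M. (S j w / real j)\<^sup>2) = (weight a j)\<^sup>2 * (LINT w|M. (mart j w)\<^sup>2)"
        by (simp only: S_div_eq[OF elim] power_mult_distrib integral_mult_right_zero)
      also have "\<dots> \<le> (weight a j)\<^sup>2 * (2 * tail 1 + 2)"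
        using expectation_mart_sq_le[OF elim] by (intro mult_left_mono) auto
      finally show ?case .
    qed
  qed simp
qed auto

text \<open>The terms before time m are correlated with Y, but their number is fixed and the scale
  diverges, so dropping them is harmless. The remaining terms form a sum to which the telescoping
  estimate applies with Y as initial factor.\<close>

lemma char_clt_sum_tendsto:
  fixes Y :: "'a \<Rightarrow> complex"
  assumes m: "m \<ge> 1" and Y: "Y \<in> borel_measurable (past m)" and B: "AE w in M. cmod (Y w) \<le> B"
  shows "(\<lambda>n. LINT w|M. Y w * iexp (\<theta> * clt_sum n w)) \<longlonglongrightarrow> (LINT w|M. Y w) * exp (- \<theta>\<^sup>2 / 2)"
proof -
  define b where "b n j = \<theta> * (weight a j / clt_scale n)" for n j
  define v where "v n = (\<Sum>j=m..<n. (b n j)\<^sup>2)" for n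
  \<comment> \<open>The first summand is the cost of dropping the terms before m; the second
    collects the variance defect and the cubic errors, the latter being one power of the scale
    smaller than the total variance.\<close>
  define R where "R n = B * (\<bar>\<theta>\<bar> * 2 * real m / clt_scale n) + B * (\<theta>\<^sup>2 / 2 * avg_sq n + 2 * \<bar>\<theta>\<bar> ^ 3 / clt_scale n)" for n
  let ?E = "\<lambda>n. LINT w|M. Y w * iexp (\<theta> * clt_sum n w)"
  have [measurable]: "Y \<in> borel_measurable M" by (rule measurable_past_M[OF Y])
  have B0: "B \<ge> 0"
  proof -
    have "AE w in M. 0 \<le> B" using B by eventually_elim (use norm_ge_zero order_trans in blast)
    then show ?thesis by simp
  qed
  have bound: "eventually (\<lambda>n. cmod (?E n - (LINT w|M. Y w) * exp (- v n / 2)) \<le> R n) sequentially"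
    \<comment> \<open>Once the scale exceeds |\<theta>|, every coefficient is at most 1 in absolute
      value, as the one-step estimate demands.\<close>
    using eventually_ge_at_top[of "max 2 m"] filterlim_at_top[THEN iffD1, OF clt_scale_at_top, rule_format, of "\<bar>\<theta>\<bar>"]
  proof eventually_elim
    case (elim n)
    have n: "n \<ge> 2" "m \<le> n" using elim by auto
    have s: "clt_scale n \<ge> 1" using clt_scale_ge_1[OF n(1)] .
    have b_le: "\<bar>b n j\<bar> \<le> \<bar>\<theta>\<bar> / clt_scale n" if "j \<ge> 1" for j
    proof -
      have "\<bar>b n j\<bar> = \<bar>\<theta>\<bar> * \<bar>weight a j\<bar> / clt_scale n"
        using s by (simp add: b_def abs_mult abs_divide)
      also have "\<dots> \<le> \<bar>\<theta>\<bar> * 1 / clt_scale n"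
        using s abs_weight_le_1[OF that] by (intro divide_right_mono mult_left_mono) auto
      finally show ?thesis by simp
    qed
    have b_le_1: "\<bar>b n j\<bar> \<le> 1" if "j \<ge> 1" for j
    proof -
      have "\<bar>\<theta>\<bar> / clt_scale n \<le> 1" using elim s by (simp add: divide_le_eq)
      then show ?thesis using b_le[OF that] by linarith
    qed
    let ?T = "\<lambda>w. \<Sum>j=m..<n. b n j * noise j w"
    have [measurable]: "?T \<in> borel_measurable M" by measurable
    have int: "integrable M (\<lambda>w. Y w * iexp (f w))" if "f \<in> borel_measurable M" for f
      using B that by (intro integrable_const_bound[where B=B]) (auto simp: norm_mult)
    have cs: "\<theta> * clt_sum n w = (\<Sum>j=1..<m. b n j * noise j w) + ?T w" for w
      using m n by (subst sum.atLeastLessThan_concat) (auto simp: clt_sum_def b_def sum_distrib_left mult_ac)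
    have "?E n - (LINT w|M. Y w * iexp (?T w)) = (LINT w|M. Y w * iexp (\<theta> * clt_sum n w) - Y w * iexp (?T w))"
      by (intro Bochner_Integration.integral_diff[symmetric] int) measurable
    also have "\<dots> = (LINT w|M. Y w * (iexp (\<theta> * clt_sum n w) - iexp (?T w)))"
      by (simp add: right_diff_distrib)
    finally have "cmod (?E n - (LINT w|M. Y w * iexp (?T w))) = cmod (LINT w|M. Y w * (iexp (\<theta> * clt_sum n w) - iexp (?T w)))"
      by (rule arg_cong)
    also have "\<dots> \<le> B * (\<bar>\<theta>\<bar> * 2 * real m / clt_scale n)"
    proof (rule norm_expectation_le_const)
      show "AE w in M. cmod (Y w * (iexp (\<theta> * clt_sum n w) - iexp (?T w))) \<le> B * (\<bar>\<theta>\<bar> * 2 * real m / clt_scale n)"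
        using B AE_bounds
      proof eventually_elim
        case (elim w)
        have "cmod (iexp (\<theta> * clt_sum n w) - iexp (?T w)) \<le> \<bar>\<Sum>j=1..<m. b n j * noise j w\<bar>"
          using cmod_iexp_diff_le[of "\<theta> * clt_sum n w" "?T w"] cs[of w] by simp
        also have "\<dots> \<le> (\<Sum>j=1..<m. \<bar>\<theta>\<bar> / clt_scale n * 2)"
        proof (rule sum_abs[THEN order_trans], rule sum_mono)
          fix j assume "j \<in> {1..<m}"
          then show "\<bar>b n j * noise j w\<bar> \<le> \<bar>\<theta>\<bar> / clt_scale n * 2"
            unfolding abs_mult using elim b_le[of j] s by (intro mult_mono) auto
        qed
        also have "\<dots> \<le> \<bar>\<theta>\<bar> * 2 * real m / clt_scale n"
        proof -
          have "(\<Sum>j=1..<m. \<bar>\<theta>\<bar> / clt_scale n * 2) = \<bar>\<theta>\<bar> * 2 * real (m - 1) / clt_scale n"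
            by simp
          also have "\<dots> \<le> \<bar>\<theta>\<bar> * 2 * real m / clt_scale n"
            using s by (intro divide_right_mono mult_left_mono) auto
          finally show ?thesis .
        qed
        finally show ?case
          unfolding norm_mult using elim B0 by (intro mult_mono) auto
      qed
    qed (use B0 s in auto)
    finally have t1: "cmod (?E n - (LINT w|M. Y w * iexp (?T w))) \<le> B * (\<bar>\<theta>\<bar> * 2 * real m / clt_scale n)" .
    have "cmod ((LINT w|M. Y w * iexp (?T w)) - (LINT w|M. Y w) * exp (- v n / 2))
        \<le> B * (\<Sum>j=m..<n. (b n j)\<^sup>2 * (LINT w|M. (S j w / real j)\<^sup>2) / 2 + 2 * \<bar>b n j\<bar> ^ 3)"
      unfolding v_def using m b_le_1 n by (intro char_noise_sum_bound Y B) auto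
    also have "\<dots> \<le> B * (\<theta>\<^sup>2 / 2 * avg_sq n + 2 * \<bar>\<theta>\<bar> ^ 3 / clt_scale n)"
    proof (intro mult_left_mono B0)
      have "(\<Sum>j=m..<n. (b n j)\<^sup>2 * (LINT w|M. (S j w / real j)\<^sup>2) / 2 + 2 * \<bar>b n j\<bar> ^ 3) \<le>
          (\<Sum>j=1..<n. (b n j)\<^sup>2 * (LINT w|M. (S j w / real j)\<^sup>2) / 2 + 2 * \<bar>b n j\<bar> ^ 3)"
        using m by (intro sum_mono2) (auto intro!: add_nonneg_nonneg mult_nonneg_nonneg integral_nonneg_AE)
      also have "\<dots> \<le> (\<Sum>j=1..<n. (\<theta>\<^sup>2 / 2) * ((weight a j)\<^sup>2 * (LINT w|M. (S j w / real j)\<^sup>2) / weight_norm_sq a n)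
          + (2 * \<bar>\<theta>\<bar> ^ 3 / clt_scale n) * ((weight a j)\<^sup>2 / weight_norm_sq a n))"
      proof (intro sum_mono add_mono)
        fix j assume j: "j \<in> {1..<n}"
        have bsq: "(b n j)\<^sup>2 = \<theta>\<^sup>2 * ((weight a j)\<^sup>2 / weight_norm_sq a n)"
          by (simp add: b_def power_mult_distrib power_divide clt_scale_sq)
        then show "(b n j)\<^sup>2 * (LINT w|M. (S j w / real j)\<^sup>2) / 2 \<le>
            (\<theta>\<^sup>2 / 2) * ((weight a j)\<^sup>2 * (LINT w|M. (S j w / real j)\<^sup>2) / weight_norm_sq a n)"
          by simp
        have "\<bar>b n j\<bar> ^ 3 = \<bar>b n j\<bar> * (b n j)\<^sup>2"
          by (simp add: power3_eq_cube power2_eq_square)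
        also have "\<dots> \<le> \<bar>\<theta>\<bar> / clt_scale n * (b n j)\<^sup>2"
          using b_le j by (intro mult_right_mono) auto
        also have "\<dots> = \<bar>\<theta>\<bar> ^ 3 / clt_scale n * ((weight a j)\<^sup>2 / weight_norm_sq a n)"
          unfolding bsq by (simp add: power3_eq_cube power2_eq_square)
        finally show "2 * \<bar>b n j\<bar> ^ 3 \<le> (2 * \<bar>\<theta>\<bar> ^ 3 / clt_scale n) * ((weight a j)\<^sup>2 / weight_norm_sq a n)"
          by simp
      qed
      also have "\<dots> = \<theta>\<^sup>2 / 2 * avg_sq n + (2 * \<bar>\<theta>\<bar> ^ 3 / clt_scale n) * (weight_norm_sq a n / weight_norm_sq a n)"
        unfolding sum.distrib avg_sq_def
        by (simp only: sum_distrib_left[symmetric] sum_divide_distrib[symmetric] weight_norm_sq_def[symmetric])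
      also have "weight_norm_sq a n / weight_norm_sq a n = 1"
        using weight_norm_sq_ge_1[OF a_bounds(3) n(1)] by simp
      finally show "(\<Sum>j=m..<n. (b n j)\<^sup>2 * (LINT w|M. (S j w / real j)\<^sup>2) / 2 + 2 * \<bar>b n j\<bar> ^ 3)
          \<le> \<theta>\<^sup>2 / 2 * avg_sq n + 2 * \<bar>\<theta>\<bar> ^ 3 / clt_scale n" by simp
    qed
    finally have t2: "cmod ((LINT w|M. Y w * iexp (?T w)) - (LINT w|M. Y w) * exp (- v n / 2))
        \<le> B * (\<theta>\<^sup>2 / 2 * avg_sq n + 2 * \<bar>\<theta>\<bar> ^ 3 / clt_scale n)" .
    show ?case
      unfolding R_def using norm_triangle_mono[OF t1 t2] by simp
  qed
  have "R \<longlonglongrightarrow> B * 0 + B * (\<theta>\<^sup>2 / 2 * 0 + 0)"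
    unfolding R_def[abs_def] by (intro tendsto_intros avg_sq_tendsto_0 const_over_clt_scale_tendsto_0)
  then have "R \<longlonglongrightarrow> 0" by simp
  then have "(\<lambda>n. ?E n - (LINT w|M. Y w) * exp (- v n / 2)) \<longlonglongrightarrow> 0"
    by (rule Lim_null_comparison[OF bound])
  moreover have "(\<lambda>n. (LINT w|M. Y w) * complex_of_real (exp (- v n / 2))) \<longlonglongrightarrow> (LINT w|M. Y w) * exp (- \<theta>\<^sup>2 / 2)"
  proof -
    \<comment> \<open>The share of the variance accumulated before m is
      \<open>weight_norm_sq a m\<close> over the squared scale; it is written as two successive
      divisions, each by a divergent sequence.\<close>
    have "(\<lambda>n. \<theta>\<^sup>2 * (1 - (weight_norm_sq a m / clt_scale n) / clt_scale n)) \<longlonglongrightarrow> \<theta>\<^sup>2 * (1 - 0)"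
      by (intro tendsto_intros tendsto_divide_0[OF const_over_clt_scale_tendsto_0 filterlim_at_top_imp_at_infinity[OF clt_scale_at_top]])
    moreover have "eventually (\<lambda>n. \<theta>\<^sup>2 * (1 - (weight_norm_sq a m / clt_scale n) / clt_scale n) = v n) sequentially"
      using eventually_ge_at_top[of "max 2 m"]
    proof eventually_elim
      case (elim n)
      have n: "n \<ge> 2" "m \<le> n" using elim by auto
      have "v n = \<theta>\<^sup>2 * ((\<Sum>j=m..<n. (weight a j)\<^sup>2) / weight_norm_sq a n)"
        by (simp add: v_def b_def power_mult_distrib power_divide clt_scale_sq sum_distrib_left sum_divide_distrib)
      also have "(\<Sum>j=m..<n. (weight a j)\<^sup>2) = weight_norm_sq a n - weight_norm_sq a m"
        unfolding weight_norm_sq_def using m n by (subst sum.atLeastLessThan_concat[of 1 m n, symmetric]) auto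
      also have "\<theta>\<^sup>2 * (\<dots> / weight_norm_sq a n) = \<theta>\<^sup>2 * (1 - (weight_norm_sq a m / clt_scale n) / clt_scale n)"
        using weight_norm_sq_ge_1[OF a_bounds(3) n(1)]
        by (simp add: diff_divide_distrib clt_scale_sq flip: power2_eq_square)
      finally show ?case by simp
    qed
    ultimately have "v \<longlonglongrightarrow> \<theta>\<^sup>2"
      by (simp add: filterlim_cong)
    then show ?thesis by (intro tendsto_intros) auto
  qed
  ultimately have "(\<lambda>n. (?E n - (LINT w|M. Y w) * exp (- v n / 2)) + (LINT w|M. Y w) * exp (- v n / 2)) \<longlonglongrightarrow>
      0 + (LINT w|M. Y w) * exp (- \<theta>\<^sup>2 / 2)"
    by (rule tendsto_add)
  then show ?thesis by simp
qed

end

section \<open>Mixing limit theorem and coverage probability\<close>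

text \<open>Here \<open>L\<close> is the limit of \<open>mart\<close>; the final theorem
  instantiates it with a positive multiple of the limit given there. Convergence is assumed, so only
  quantitative closeness has to be derived.\<close>

locale superdiffusive_limit = superdiffusive_erw +
  fixes L :: "'a \<Rightarrow> real"
  assumes L_measurable [measurable]: "L \<in> borel_measurable M"
    and mart_tendsto: "AE w in M. (\<lambda>n. mart n w) \<longlonglongrightarrow> L w"
begin

text \<open>Fatou's lemma carries the bound, uniform in the later time, over to the almost sure
  limit and yields integrability along with it.\<close>

lemma mart_limit_sq:
  assumes m: "m \<ge> 1"
  shows "integrable M (\<lambda>w. (L w - mart m w)\<^sup>2)"
    and "(LINT w|M. (L w - mart m w)\<^sup>2) \<le> tail m"
proof -
  have "(\<integral>\<^sup>+w. ennreal ((L w - mart m w)\<^sup>2) \<partial>M) = (\<integral>\<^sup>+w. liminf (\<lambda>n. ennreal ((mart n w - mart m w)\<^sup>2)) \<partial>M)"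
  proof (rule nn_integral_cong_AE)
    show "AE w in M. ennreal ((L w - mart m w)\<^sup>2) = liminf (\<lambda>n. ennreal ((mart n w - mart m w)\<^sup>2))"
      using mart_tendsto
    proof eventually_elim
      case (elim w)
      then have "(\<lambda>n. ennreal ((mart n w - mart m w)\<^sup>2)) \<longlonglongrightarrow> ennreal ((L w - mart m w)\<^sup>2)"
        by (intro tendsto_intros)
      then show ?case
        by (metis lim_imp_Liminf trivial_limit_sequentially)
    qed
  qed
  also have "\<dots> \<le> liminf (\<lambda>n. \<integral>\<^sup>+w. ennreal ((mart n w - mart m w)\<^sup>2) \<partial>M)"
    by (rule nn_integral_liminf) measurable
  also have "\<dots> \<le> ennreal (tail m)"
  proof (rule Liminf_le)
    show "eventually (\<lambda>n. (\<integral>\<^sup>+w. ennreal ((mart n w - mart m w)\<^sup>2) \<partial>M) \<le> ennreal (tail m)) sequentially"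
      using eventually_ge_at_top[of m]
    proof eventually_elim
      case (elim n)
      have "(\<integral>\<^sup>+w. ennreal ((mart n w - mart m w)\<^sup>2) \<partial>M) = ennreal (LINT w|M. (mart n w - mart m w)\<^sup>2)"
        by (intro nn_integral_eq_integral integrable_mart_diff_sq) (use m elim in auto)
      then show ?case using expectation_mart_diff_sq_le[OF m elim] by (simp add: ennreal_leI)
    qed
  qed simp
  finally have le: "(\<integral>\<^sup>+w. ennreal ((L w - mart m w)\<^sup>2) \<partial>M) \<le> ennreal (tail m)" .
  then show int: "integrable M (\<lambda>w. (L w - mart m w)\<^sup>2)"
    by (intro integrableI_nonneg) (auto intro: le_less_trans)
  have "(\<integral>\<^sup>+w. ennreal ((L w - mart m w)\<^sup>2) \<partial>M) = ennreal (LINT w|M. (L w - mart m w)\<^sup>2)"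
    by (intro nn_integral_eq_integral int) auto
  with le show "(LINT w|M. (L w - mart m w)\<^sup>2) \<le> tail m"
    using tail_nonneg[OF m] by simp
qed

section \<open>Conditioning on a non-zero limit\<close>

definition A :: "'a set" where
  "A = {w \<in> space M. L w \<noteq> 0}"

lemma A_event [measurable]: "A \<in> events"
  unfolding A_def by measurable

text \<open>If the limit were almost surely 0, the second moment of \<open>mart m\<close> would be
  its mean-square distance from the limit, hence at most \<open>tail m\<close> and eventually below
  1, contradicting the lower bound 1. Positivity makes the conditional probability a genuine
  quotient.\<close>

lemma prob_A_pos: "prob A > 0"
proof (rule ccontr)
  assume "\<not> prob A > 0"
  then have "prob A = 0" using measure_nonneg[of M A] by linarith
  then have ae: "AE w in M. L w = 0"
    unfolding A_def by (subst (asm) prob_Collect_eq_0) auto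
  have "eventually (\<lambda>m. tail m < 1) sequentially"
    using tail_tendsto_0 by (rule order_tendstoD) simp
  then obtain m where m: "m \<ge> 1" "tail m < 1"
    unfolding eventually_sequentially by (metis linear)
  have "(LINT w|M. (mart m w)\<^sup>2) = (LINT w|M. (L w - mart m w)\<^sup>2)"
    by (rule integral_cong_AE) (use ae in \<open>auto elim!: eventually_mono\<close>)
  then show False
    using mart_limit_sq(2)[OF m(1)] m(2) expectation_mart_sq_ge_1[OF m(1)] by linarith
qed

text \<open>The event depends on the whole trajectory, whereas the central limit theorem above
  admits only factors known at a finite time. The indicator is therefore replaced by a continuous
  function of the limit, and then the limit by the martingale at time m.\<close>

lemma indicator_A_approx:
  assumes "e > 0"
  obtains m Y where "m \<ge> 1" "Y \<in> borel_measurable (past m)" "\<And>w. 0 \<le> Y w \<and> Y w \<le> (1 :: real)"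
    "(LINT w|M. \<bar>indicator A w - Y w\<bar>) < e"
proof -
  \<comment> \<open>Continuous truncations vanishing at 0 and increasing to the indicator of the
    nonzero reals. The slope k is fixed before m is chosen.\<close>
  define h where "h k x = min 1 (real k * \<bar>x\<bar>)" for k x
  have h01: "0 \<le> h k x \<and> h k x \<le> 1" for k x by (simp add: h_def)
  have hb: "norm \<bar>indicator A w - h k x\<bar> \<le> 1" for w k x
    using h01[of k x] by (cases "w \<in> A") (simp_all add: abs_le_iff)
  have [measurable]: "h k \<in> borel_measurable borel" for k unfolding h_def by measurable
  have "(\<lambda>k. LINT w|M. \<bar>indicator A w - h k (L w)\<bar>) \<longlonglongrightarrow> (LINT w|M. 0)"
  proof (rule integral_dominated_convergence[where w="\<lambda>_. 1"])
    show "AE w in M. (\<lambda>k. \<bar>indicator A w - h k (L w)\<bar>) \<longlonglongrightarrow> 0"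
    proof (rule AE_I2)
      fix w assume w: "w \<in> space M"
      show "(\<lambda>k. \<bar>indicator A w - h k (L w)\<bar>) \<longlonglongrightarrow> 0"
      proof (cases "L w = 0")
        case True
        then show ?thesis by (simp add: A_def h_def)
      next
        case False
        have "eventually (\<lambda>k. real k \<ge> 1 / \<bar>L w\<bar>) sequentially"
          using filterlim_real_sequentially unfolding filterlim_at_top by blast
        then have "eventually (\<lambda>k. \<bar>indicator A w - h k (L w)\<bar> = 0) sequentially"
        proof eventually_elim
          case (elim k)
          then have "1 \<le> real k * \<bar>L w\<bar>" using False by (simp add: field_simps)
          then show ?case using w False by (simp add: A_def h_def)
        qed
        then show ?thesis by (rule tendsto_eventually)
      qed
    qed
    show "AE w in M. norm \<bar>indicator A w - h k (L w)\<bar> \<le> 1" for k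
      by (intro AE_I2 hb)
  qed auto
  then have "eventually (\<lambda>k. (LINT w|M. \<bar>indicator A w - h k (L w)\<bar>) < e / 2) sequentially"
    by (intro order_tendstoD(2)[where y=0]) (use assms in auto)
  then obtain k where k: "(LINT w|M. \<bar>indicator A w - h k (L w)\<bar>) < e / 2"
    by (auto simp: eventually_sequentially)
  have "(\<lambda>m. LINT w|M. \<bar>h k (L w) - h k (mart m w)\<bar>) \<longlonglongrightarrow> (LINT w|M. 0)"
  proof (rule integral_dominated_convergence[where w="\<lambda>_. 1"])
    show "AE w in M. (\<lambda>m. \<bar>h k (L w) - h k (mart m w)\<bar>) \<longlonglongrightarrow> 0"
      using mart_tendsto
    proof eventually_elim
      case (elim w)
      then have "(\<lambda>m. \<bar>h k (L w) - h k (mart m w)\<bar>) \<longlonglongrightarrow> \<bar>h k (L w) - h k (L w)\<bar>"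
        unfolding h_def by (intro tendsto_intros)
      then show ?case by simp
    qed
    show "AE w in M. norm \<bar>h k (L w) - h k (mart m w)\<bar> \<le> 1" for m
    proof (rule AE_I2)
      fix w show "norm \<bar>h k (L w) - h k (mart m w)\<bar> \<le> 1"
        using h01[of k "L w"] h01[of k "mart m w"] by (simp add: abs_le_iff)
    qed
  qed auto
  then have "eventually (\<lambda>m. (LINT w|M. \<bar>h k (L w) - h k (mart m w)\<bar>) < e / 2) sequentially"
    by (intro order_tendstoD(2)[where y=0]) (use assms in auto)
  then obtain m where m: "m \<ge> 1" "(LINT w|M. \<bar>h k (L w) - h k (mart m w)\<bar>) < e / 2"
    unfolding eventually_sequentially by (metis linear)
  have i1: "integrable M (\<lambda>w. \<bar>indicator A w - h k (L w)\<bar>)"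
    by (rule integrable_const_bound[where B=1]) (auto intro!: AE_I2 hb simp del: real_norm_def)
  have i2: "integrable M (\<lambda>w. \<bar>h k (L w) - h k (mart m w)\<bar>)"
  proof (rule integrable_const_bound[where B=1])
    show "AE w in M. norm \<bar>h k (L w) - h k (mart m w)\<bar> \<le> 1"
    proof (rule AE_I2)
      fix w show "norm \<bar>h k (L w) - h k (mart m w)\<bar> \<le> 1"
        using h01[of k "L w"] h01[of k "mart m w"] by (simp add: abs_le_iff)
    qed
  qed measurable
  have "(LINT w|M. \<bar>indicator A w - h k (mart m w)\<bar>) \<le>
      (LINT w|M. \<bar>indicator A w - h k (L w)\<bar> + \<bar>h k (L w) - h k (mart m w)\<bar>)"
    by (rule integral_mono_AE') (use i1 i2 in auto)
  also have "\<dots> = (LINT w|M. \<bar>indicator A w - h k (L w)\<bar>) + (LINT w|M. \<bar>h k (L w) - h k (mart m w)\<bar>)"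
    using i1 i2 by simp
  also have "\<dots> < e" using k m(2) by simp
  finally have fin: "(LINT w|M. \<bar>indicator A w - h k (mart m w)\<bar>) < e" .
  have "(\<lambda>w. h k (mart m w)) \<in> borel_measurable (past m)"
    by (rule measurable_compose[OF mart_past[OF order_refl]]) measurable
  then show ?thesis by (rule that[OF m(1)]) (use h01 fin in auto)
qed

text \<open>The exponential has modulus 1, so exchanging the indicator for Y costs at most the mean
  distance of the two, uniformly in n. This uniformity permits fixing Y before letting n
  grow.\<close>

lemma char_clt_sum_on_A_tendsto:
  "(\<lambda>n. LINT w|M. indicator A w * iexp (\<theta> * clt_sum n w)) \<longlonglongrightarrow> prob A * exp (- \<theta>\<^sup>2 / 2)"
proof (rule LIMSEQ_I)
  fix e :: real assume e: "e > 0"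
  obtain m Y where m: "m \<ge> 1" and Y: "Y \<in> borel_measurable (past m)" "\<And>w. 0 \<le> Y w \<and> Y w \<le> (1 :: real)"
    and close: "(LINT w|M. \<bar>indicator A w - Y w\<bar>) < e / 3"
    using indicator_A_approx[of "e / 3"] e by auto
  let ?Y = "\<lambda>w. complex_of_real (Y w)" and ?I = "\<lambda>w. complex_of_real (indicator A w)"
  let ?g = "complex_of_real (exp (- \<theta>\<^sup>2 / 2))"
  have [measurable]: "Y \<in> borel_measurable M" by (rule measurable_past_M[OF Y(1)])
  have YC: "?Y \<in> borel_measurable (past m)" using Y(1) by measurable
  have iI: "integrable M (\<lambda>w. ?I w * f w)" and iY: "integrable M (\<lambda>w. ?Y w * f w)"
    if "f \<in> borel_measurable M" "\<And>w. cmod (f w) = 1" for f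
    using that Y(2) by (auto intro!: integrable_const_bound[where B=1] AE_I2 simp: norm_mult indicator_def)
  have diff: "cmod ((LINT w|M. ?I w * f w) - (LINT w|M. ?Y w * f w)) < e / 3"
    if f: "f \<in> borel_measurable M" "\<And>w. cmod (f w) = 1" for f
  proof -
    have "(LINT w|M. ?I w * f w) - (LINT w|M. ?Y w * f w) = (LINT w|M. ?I w * f w - ?Y w * f w)"
      using iI[OF f] iY[OF f] by simp
    then have "cmod ((LINT w|M. ?I w * f w) - (LINT w|M. ?Y w * f w)) = cmod (LINT w|M. ?I w * f w - ?Y w * f w)"
      by (rule arg_cong)
    also have "\<dots> \<le> (LINT w|M. cmod (?I w * f w - ?Y w * f w))"
      by (rule integral_norm_bound)
    also have "\<dots> = (LINT w|M. \<bar>indicator A w - Y w\<bar>)"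
    proof (rule Bochner_Integration.integral_cong)
      fix w
      have "cmod (?I w * f w - ?Y w * f w) = cmod (complex_of_real (indicator A w - Y w)) * cmod (f w)"
        by (simp only: norm_mult[symmetric] left_diff_distrib of_real_diff)
      then show "cmod (?I w * f w - ?Y w * f w) = \<bar>indicator A w - Y w\<bar>"
        by (simp only: f(2) norm_of_real mult_1_right)
    qed simp
    finally show ?thesis using close by linarith
  qed
  have 1: "cmod ((LINT w|M. ?I w * iexp (\<theta> * clt_sum n w)) - (LINT w|M. ?Y w * iexp (\<theta> * clt_sum n w))) < e / 3" for n
    by (rule diff) auto
  have "cmod ((LINT w|M. ?I w * 1) - (LINT w|M. ?Y w * 1)) < e / 3"
    by (rule diff) auto
  moreover have "(LINT w|M. ?I w * 1) = complex_of_real (prob A)"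
    by simp
  ultimately have 2: "cmod ((LINT w|M. ?Y w) - complex_of_real (prob A)) < e / 3"
    by (simp add: norm_minus_commute)
  have 2: "cmod ((LINT w|M. ?Y w) * ?g - complex_of_real (prob A) * ?g) < e / 3"
  proof -
    have "cmod ((LINT w|M. ?Y w) * ?g - complex_of_real (prob A) * ?g) = cmod ((LINT w|M. ?Y w) - complex_of_real (prob A)) * cmod ?g"
      by (simp only: norm_mult[symmetric] left_diff_distrib)
    also have "\<dots> \<le> cmod ((LINT w|M. ?Y w) - complex_of_real (prob A)) * 1"
      by (intro mult_left_mono) auto
    finally show ?thesis using 2 by linarith
  qed
  have "(\<lambda>n. LINT w|M. ?Y w * iexp (\<theta> * clt_sum n w)) \<longlonglongrightarrow> (LINT w|M. ?Y w) * ?g"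
    by (rule char_clt_sum_tendsto[OF m YC, where B=1]) (use Y(2) in auto)
  from LIMSEQ_D[OF this, of "e / 3"] e obtain N where N: "\<And>n. n \<ge> N \<Longrightarrow> cmod ((LINT w|M. ?Y w * iexp (\<theta> * clt_sum n w)) - (LINT w|M. ?Y w) * ?g) < e / 3"
    by auto
  have "cmod ((LINT w|M. ?I w * iexp (\<theta> * clt_sum n w)) - complex_of_real (prob A) * ?g) < e" if "n \<ge> N" for n
  proof -
    have tri: "cmod (x - z') < e" if "cmod (x - y) < e / 3" "cmod (y - z) < e / 3" "cmod (z - z') < e / 3" for x y z z'
      using norm_triangle_ineq[of "x - y" "y - z"] norm_triangle_ineq[of "x - z" "z - z'"] that by simp
    show ?thesis by (rule tri[OF 1 N[OF that] 2])
  qed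
  moreover have "?I w = indicator A w" for w by (simp add: indicator_def)
  ultimately show "\<exists>N. \<forall>n\<ge>N. norm ((LINT w|M. indicator A w * iexp (\<theta> * clt_sum n w)) - prob A * exp (- \<theta>\<^sup>2 / 2)) < e"
    by (auto intro!: exI[of _ N])
qed

text \<open>Under the law conditioned on A, the characteristic functions are the preceding
  expectations divided by \<open>prob A\<close>; Levy continuity gives weak convergence, and the
  endpoints of the interval carry no normal mass.\<close>

lemma clt_on_A:
  assumes "t \<ge> 0"
  shows "(\<lambda>n. prob {w \<in> space M. \<bar>clt_sum n w\<bar> \<le> t \<and> L w \<noteq> 0}) \<longlonglongrightarrow> prob A * measure std_normal_distribution {-t..t}"
proof -
  define Q where "Q = uniform_measure M A"
  have eA: "emeasure M A \<noteq> 0" "emeasure M A \<noteq> \<infinity>"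
    using prob_A_pos by (auto simp: emeasure_eq_measure)
  interpret Q: prob_space Q
    unfolding Q_def by (rule prob_space_uniform_measure[OF eA])
  have [measurable_cong]: "sets Q = sets M" by (simp add: Q_def)
  have spQ: "space Q = space M" by (simp add: Q_def)
  have clt_meas [measurable]: "clt_sum n \<in> borel_measurable Q" for n by measurable
  let ?D = "\<lambda>n. distr Q borel (clt_sum n)"
  have QD: "Q = density M (\<lambda>w. ennreal (indicator A w / prob A))"
    unfolding Q_def uniform_measure_def
    by (rule density_cong) (use prob_A_pos in \<open>auto simp: emeasure_eq_measure divide_ennreal simp flip: ennreal_1 ennreal_indicator split: split_indicator\<close>)
  have "weak_conv_m ?D std_normal_distribution"
  proof (rule levy_continuity)
    show "real_distribution (?D n)" for n
      by (rule Q.real_distribution_distr) measurable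
    show "real_distribution std_normal_distribution" by (rule real_dist_normal_dist)
    fix \<theta>
    have char: "char (?D n) \<theta> = (LINT w|M. indicator A w * iexp (\<theta> * clt_sum n w)) / prob A" for n
    proof -
      have "char (?D n) \<theta> = (LINT w|Q. iexp (\<theta> * clt_sum n w))"
        unfolding char_def by (subst integral_distr) auto
      also have "\<dots> = (LINT w|M. (indicator A w / prob A) *\<^sub>R iexp (\<theta> * clt_sum n w))"
        unfolding QD by (subst integral_density) auto
      also have "\<dots> = (LINT w|M. (indicator A w * iexp (\<theta> * clt_sum n w)) / prob A)"
        by (intro Bochner_Integration.integral_cong) (auto simp: scaleR_conv_of_real indicator_def)
      also have "\<dots> = (LINT w|M. indicator A w * iexp (\<theta> * clt_sum n w)) / prob A"
        by simp
      finally show ?thesis .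
    qed
    have lim0: "(\<lambda>n. LINT w|M. indicator A w * iexp (\<theta> * clt_sum n w)) \<longlonglongrightarrow> complex_of_real (prob A) * complex_of_real (exp (- \<theta>\<^sup>2 / 2))"
      using char_clt_sum_on_A_tendsto[of \<theta>] by (simp only: of_real_mult)
    have lim: "(\<lambda>n. (LINT w|M. indicator A w * iexp (\<theta> * clt_sum n w)) / prob A) \<longlonglongrightarrow> (complex_of_real (prob A) * complex_of_real (exp (- \<theta>\<^sup>2 / 2))) / complex_of_real (prob A)"
      by (intro tendsto_divide lim0 tendsto_const) (use prob_A_pos in auto)
    have "char std_normal_distribution \<theta> = (complex_of_real (prob A) * complex_of_real (exp (- \<theta>\<^sup>2 / 2))) / complex_of_real (prob A)"
      using prob_A_pos by (simp add: char_std_normal_distribution)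
    with lim show "(\<lambda>n. char (?D n) \<theta>) \<longlonglongrightarrow> char std_normal_distribution \<theta>"
      by (simp only: char)
  qed
  then have "(\<lambda>n. measure (?D n) {-t..t}) \<longlonglongrightarrow> measure std_normal_distribution {-t..t}"
  proof (rule weak_conv_imp_continuity_set_conv[rotated 2])
    show "real_distribution (?D n)" for n
      by (rule Q.real_distribution_distr) measurable
    show "real_distribution std_normal_distribution" by (rule real_dist_normal_dist)
    have "frontier {-t..t} = {-t, t}"
      using assms by (auto simp: frontier_def)
    moreover have "emeasure std_normal_distribution {-t, t} = 0"
      by (subst emeasure_density) (auto intro!: nn_integral_null_set[THEN trans] simp: null_sets_def emeasure_lborel_countable)
    ultimately show "emeasure std_normal_distribution (frontier {-t..t}) = 0" by simp
  qed auto
  moreover have "measure (?D n) {-t..t} = prob {w \<in> space M. \<bar>clt_sum n w\<bar> \<le> t \<and> L w \<noteq> 0} / prob A" for n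
  proof -
    have "measure (?D n) {-t..t} = measure Q {w \<in> space M. \<bar>clt_sum n w\<bar> \<le> t}"
      by (subst measure_distr) (auto simp: spQ abs_le_iff intro!: arg_cong[where f="measure Q"])
    also have "\<dots> = prob (A \<inter> {w \<in> space M. \<bar>clt_sum n w\<bar> \<le> t}) / prob A"
      unfolding Q_def by (rule measure_uniform_measure[OF eA]) measurable
    also have "A \<inter> {w \<in> space M. \<bar>clt_sum n w\<bar> \<le> t} = {w \<in> space M. \<bar>clt_sum n w\<bar> \<le> t \<and> L w \<noteq> 0}"
      by (auto simp: A_def)
    finally show ?thesis .
  qed
  ultimately have "(\<lambda>n. prob A * (prob {w \<in> space M. \<bar>clt_sum n w\<bar> \<le> t \<and> L w \<noteq> 0} / prob A)) \<longlonglongrightarrow> prob A * measure std_normal_distribution {-t..t}"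
    by (intro tendsto_intros) simp
  then show ?thesis using prob_A_pos by simp
qed

section \<open>From deterministic weights to the self-normalised sum\<close>

definition score :: "nat \<Rightarrow> 'a \<Rightarrow> real" where
  "score n w = (\<Sum>j=1..<n. S j w / real j * noise j w)"

text \<open>For n \<ge> 1 one has V = 4 \<open>energy\<close>, and the estimation error is
  \<open>score\<close> / (2 \<open>energy\<close>) as soon as \<open>energy\<close> is
  positive.\<close>

definition energy :: "nat \<Rightarrow> 'a \<Rightarrow> real" where
  "energy n w = (\<Sum>j=1..<n. (S j w / real j)\<^sup>2)"

definition residual :: "nat \<Rightarrow> 'a \<Rightarrow> real" where
  "residual n w = score n w / clt_scale n - L w * clt_sum n w"

lemma score_measurable [measurable]: "score n \<in> borel_measurable M"
  unfolding score_def by measurable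

lemma energy_measurable [measurable]: "energy n \<in> borel_measurable M"
  unfolding energy_def by measurable

lemma residual_measurable [measurable]: "residual n \<in> borel_measurable M"
  unfolding residual_def by measurable

text \<open>The limit is not predictable, so the martingale is frozen at time m. This leaves the
  early terms \<open>Q\<close>, a noise sum \<open>P\<close> with the predictable coefficients of
  \<open>mart j - mart m\<close>, and the product of \<open>mart m - L\<close> with
  \<open>clt_sum n\<close>. The last two are split by the arithmetic-geometric mean inequality with
  parameter \<eta>. Their contributions (4 tail / \<eta> + \<eta>) / 2 and (tail / \<eta> + 4
  \<eta>) / 2 add up to the factor 5/2.\<close>

lemma expectation_abs_residual_le:
  assumes m: "m \<ge> 1" and n: "n \<ge> 2" "m \<le> n" and \<eta>: "\<eta> > 0"
  shows "integrable M (residual n)"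
    and "(LINT w|M. \<bar>residual n w\<bar>) \<le> 4 * (real m)\<^sup>2 / clt_scale n + 5 / 2 * (tail m / \<eta> + \<eta>)"
proof -
  define H where "H j w = (mart j w - mart m w) * (weight a j / clt_scale n)" for j w
  define P where "P w = (\<Sum>j=m..<n. H j w * noise j w)" for w
  define Q where "Q w = (\<Sum>j=1..<m. H j w * noise j w)" for w
  define G where "G w = 4 * (real m)\<^sup>2 / clt_scale n + ((P w)\<^sup>2 / \<eta> + \<eta>) / 2 + ((L w - mart m w)\<^sup>2 / \<eta> + \<eta> * (clt_sum n w)\<^sup>2) / 2" for w
  have s: "clt_scale n \<ge> 1" by (rule clt_scale_ge_1[OF n(1)])
  have [measurable]: "H j \<in> borel_measurable M" for j
    unfolding H_def by measurable
  have [measurable]: "P \<in> borel_measurable M"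
    unfolding P_def by measurable
  have H_past: "H j \<in> borel_measurable (past j)" if "j \<ge> m" for j
    using mart_past[of j j] mart_past[OF that] unfolding H_def by measurable
  have w_le: "\<bar>weight a j / clt_scale n\<bar> \<le> 1 / clt_scale n" if "j \<ge> 1" for j
    unfolding abs_divide using abs_weight_le_1[OF that] s by (intro frac_le) auto
  have H_bound: "AE w in M. \<bar>H j w\<bar> \<le> (real j + real m) * (1 / clt_scale n)" if "j \<ge> 1" for j
    using AE_abs_mart_diff_le[OF m that]
  proof eventually_elim
    case (elim w)
    show ?case unfolding H_def abs_mult using elim w_le[OF that] by (intro mult_mono) auto
  qed
  have decomp: "residual n w = Q w + P w + (mart m w - L w) * clt_sum n w" for w
  proof -
    have "score n w / clt_scale n = (\<Sum>j=1..<n. mart j w * (weight a j / clt_scale n) * noise j w)"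
      unfolding score_def sum_divide_distrib
    proof (intro sum.cong refl)
      fix j assume "j \<in> {1..<n}"
      then have j: "j \<ge> 1" by simp
      show "S j w / real j * noise j w / clt_scale n = mart j w * (weight a j / clt_scale n) * noise j w"
        unfolding S_div_eq[OF j] by simp
    qed
    also have "\<dots> = (\<Sum>j=1..<n. H j w * noise j w + mart m w * (weight a j / clt_scale n * noise j w))"
      by (intro sum.cong) (auto simp: H_def algebra_simps diff_divide_distrib)
    also have "\<dots> = (\<Sum>j=1..<n. H j w * noise j w) + mart m w * clt_sum n w"
      by (simp only: sum.distrib clt_sum_def sum_distrib_left)
    also have "(\<Sum>j=1..<n. H j w * noise j w) = Q w + P w"
      unfolding Q_def P_def using m n by (intro sum.atLeastLessThan_concat[symmetric])
    finally show ?thesis by (simp add: residual_def left_diff_distrib)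
  qed
  \<comment> \<open>Fewer than m terms, each with |mart j - mart m| \<le> 2 m, weight at most 1 and
    noise at most 2.\<close>
  have Q_bound: "AE w in M. \<bar>Q w\<bar> \<le> 4 * (real m)\<^sup>2 / clt_scale n"
  proof -
    have ae: "AE w in M. \<bar>Q w\<bar> \<le> (\<Sum>j=1..<m. (real j + real m) * (1 / clt_scale n) * 2)"
      unfolding Q_def by (rule AE_abs_noise_sum_le[OF order_refl H_bound])
    have le: "(\<Sum>j=1..<m. (real j + real m) * (1 / clt_scale n) * 2) \<le> 4 * (real m)\<^sup>2 / clt_scale n"
    proof -
      have "(\<Sum>j=1..<m. (real j + real m) * (1 / clt_scale n) * 2) \<le> (\<Sum>j=1..<m. 4 * real m / clt_scale n)"
        using s by (intro sum_mono) (auto simp: field_simps)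
      also have "\<dots> = 4 * real m * real (m - 1) / clt_scale n" by simp
      also have "\<dots> \<le> 4 * real m * real m / clt_scale n"
        using s by (intro divide_right_mono mult_left_mono) auto
      finally show ?thesis by (simp add: power2_eq_square)
    qed
    show ?thesis
      using ae by eventually_elim (rule order_trans[OF _ le])
  qed
  have amgm: "\<bar>x * y\<bar> \<le> (x\<^sup>2 / \<eta> + \<eta> * y\<^sup>2) / 2" for x y
  proof -
    have "0 \<le> (\<bar>x\<bar> - \<eta> * \<bar>y\<bar>)\<^sup>2 / \<eta>" using \<eta> by simp
    also have "\<dots> = x\<^sup>2 / \<eta> + \<eta> * y\<^sup>2 - 2 * \<bar>x * y\<bar>"
      using \<eta> by (simp add: power2_diff power_mult_distrib abs_mult field_simps power2_eq_square)
    finally show ?thesis by simp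
  qed
  have le_G: "AE w in M. \<bar>residual n w\<bar> \<le> G w"
    using Q_bound
  proof eventually_elim
    case (elim w)
    have "\<bar>residual n w\<bar> \<le> \<bar>Q w\<bar> + \<bar>P w\<bar> + \<bar>(mart m w - L w) * clt_sum n w\<bar>"
      unfolding decomp by linarith
    \<comment> \<open>For \<open>P\<close> the inequality is applied with second factor 1, which
      turns its absolute value into its square.\<close>
    also have "\<dots> \<le> G w"
      unfolding G_def using elim amgm[of "P w" 1] amgm[of "mart m w - L w" "clt_sum n w"]
      by (intro add_mono) (auto simp: power2_commute)
    finally show ?case .
  qed
  have iP: "integrable M (\<lambda>w. (P w)\<^sup>2)"
  proof (rule integrable_square_of_bounded)
    show "AE w in M. \<bar>P w\<bar> \<le> (\<Sum>j=m..<n. (real j + real m) * (1 / clt_scale n) * 2)"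
      unfolding P_def by (rule AE_abs_noise_sum_le[OF m H_bound]) (use m in auto)
  qed measurable
  have iC: "integrable M (\<lambda>w. (clt_sum n w)\<^sup>2)"
  proof (rule integrable_square_of_bounded)
    show "AE w in M. \<bar>clt_sum n w\<bar> \<le> (\<Sum>j=1..<n. \<bar>weight a j / clt_scale n\<bar> * 2)"
      unfolding clt_sum_def by (rule AE_abs_noise_sum_le[OF order_refl]) auto
  qed measurable
  have iG: "integrable M G"
    unfolding G_def using iP iC mart_limit_sq(1)[OF m] by simp
  show int: "integrable M (residual n)"
    by (rule Bochner_Integration.integrable_bound[OF iG])
      (use le_G in \<open>auto elim!: eventually_mono intro: order_trans[OF _ abs_ge_self]\<close>)
  have EP: "(LINT w|M. (P w)\<^sup>2) \<le> 4 * tail m"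
  proof -
    have "(LINT w|M. (P w)\<^sup>2) \<le> 4 * (\<Sum>j=m..<n. LINT w|M. (H j w)\<^sup>2)"
      unfolding P_def by (rule expectation_noise_sum_sq_le[OF m H_past H_bound]) (use m in auto)
    also have "\<dots> \<le> 4 * (\<Sum>j=m..<n. tail m * ((weight a j)\<^sup>2 / weight_norm_sq a n))"
    proof (intro mult_left_mono sum_mono)
      fix j assume j: "j \<in> {m..<n}"
      have "(LINT w|M. (H j w)\<^sup>2) = (LINT w|M. (mart j w - mart m w)\<^sup>2) * ((weight a j)\<^sup>2 / weight_norm_sq a n)"
        by (simp only: H_def power_mult_distrib power_divide clt_scale_sq integral_mult_left_zero)
      also have "\<dots> \<le> tail m * ((weight a j)\<^sup>2 / weight_norm_sq a n)"
        using j m weight_norm_sq_ge_1[OF a_bounds(3) n(1)]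
        by (intro mult_right_mono expectation_mart_diff_sq_le) auto
      finally show "(LINT w|M. (H j w)\<^sup>2) \<le> tail m * ((weight a j)\<^sup>2 / weight_norm_sq a n)" .
    qed auto
    also have "\<dots> = 4 * (tail m * ((\<Sum>j=m..<n. (weight a j)\<^sup>2) / weight_norm_sq a n))"
      by (simp only: sum_distrib_left sum_divide_distrib)
    also have "\<dots> \<le> 4 * (tail m * 1)"
    proof (intro mult_left_mono tail_nonneg m)
      have "(\<Sum>j=m..<n. (weight a j)\<^sup>2) \<le> weight_norm_sq a n"
        unfolding weight_norm_sq_def using m by (intro sum_mono2) auto
      then show "(\<Sum>j=m..<n. (weight a j)\<^sup>2) / weight_norm_sq a n \<le> 1"
        using weight_norm_sq_ge_1[OF a_bounds(3) n(1)] by (simp add: divide_le_eq)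
    qed auto
    finally show ?thesis by simp
  qed
  have EC: "(LINT w|M. (clt_sum n w)\<^sup>2) \<le> 4"
  proof -
    have "(LINT w|M. (clt_sum n w)\<^sup>2) \<le> 4 * (\<Sum>j=1..<n. LINT w|M. (weight a j / clt_scale n)\<^sup>2)"
      unfolding clt_sum_def
      by (rule expectation_noise_sum_sq_le[OF order_refl, where B="\<lambda>j. \<bar>weight a j / clt_scale n\<bar>"]) auto
    also have "\<dots> = 4 * ((\<Sum>j=1..<n. (weight a j)\<^sup>2) / weight_norm_sq a n)"
      by (simp add: prob_space power_divide clt_scale_sq sum_divide_distrib)
    also have "\<dots> = 4 * (weight_norm_sq a n / weight_norm_sq a n)"
      by (simp only: weight_norm_sq_def)
    also have "\<dots> \<le> 4" by simp
    finally show ?thesis .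
  qed
  have "(LINT w|M. \<bar>residual n w\<bar>) \<le> (LINT w|M. G w)"
    by (rule integral_mono_AE) (use int iG le_G in auto)
  also have "\<dots> = 4 * (real m)\<^sup>2 / clt_scale n + ((LINT w|M. (P w)\<^sup>2) / \<eta> + \<eta>) / 2 +
      ((LINT w|M. (L w - mart m w)\<^sup>2) / \<eta> + \<eta> * (LINT w|M. (clt_sum n w)\<^sup>2)) / 2"
    unfolding G_def using iP iC mart_limit_sq(1)[OF m] by (simp add: prob_space)
  also have "\<dots> \<le> 4 * (real m)\<^sup>2 / clt_scale n + (4 * tail m / \<eta> + \<eta>) / 2 + (tail m / \<eta> + \<eta> * 4) / 2"
    using \<eta> EP EC mart_limit_sq(2)[OF m]
    by (intro add_mono divide_right_mono mult_left_mono order_refl) auto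
  also have "\<dots> = 4 * (real m)\<^sup>2 / clt_scale n + 5 / 2 * (tail m / \<eta> + \<eta>)"
    by (simp add: field_simps)
  finally show "(LINT w|M. \<bar>residual n w\<bar>) \<le> 4 * (real m)\<^sup>2 / clt_scale n + 5 / 2 * (tail m / \<eta> + \<eta>)" .
qed

lemma expectation_abs_residual_tendsto_0: "(\<lambda>n. LINT w|M. \<bar>residual n w\<bar>) \<longlonglongrightarrow> 0"
proof (rule LIMSEQ_I)
  fix e :: real assume e: "e > 0"
  \<comment> \<open>With \<open>tail m\<close> below the square of \<eta>, the second part of the
    bound is below 5 \<eta> = e / 2.\<close>
  define \<eta> where "\<eta> = e / 10"
  have \<eta>: "\<eta> > 0" using e by (simp add: \<eta>_def)
  have "eventually (\<lambda>m. tail m < \<eta>\<^sup>2) sequentially"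
    using tail_tendsto_0 by (rule order_tendstoD) (use \<eta> in simp)
  then obtain m where m: "m \<ge> 1" "tail m < \<eta>\<^sup>2"
    unfolding eventually_sequentially by (metis linear)
  have t: "tail m / \<eta> < \<eta>" using m(2) \<eta> by (simp add: divide_less_eq power2_eq_square)
  have "eventually (\<lambda>n. 4 * (real m)\<^sup>2 / clt_scale n < e / 2) sequentially"
    using const_over_clt_scale_tendsto_0 by (rule order_tendstoD) (use e in simp)
  then have "eventually (\<lambda>n. norm ((LINT w|M. \<bar>residual n w\<bar>) - 0) < e) sequentially"
    using eventually_ge_at_top[of "max 2 m"]
  proof eventually_elim
    case (elim n)
    have "(LINT w|M. \<bar>residual n w\<bar>) \<le> 4 * (real m)\<^sup>2 / clt_scale n + 5 / 2 * (tail m / \<eta> + \<eta>)"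
      by (rule expectation_abs_residual_le(2)[OF m(1) _ _ \<eta>]) (use elim in auto)
    moreover have "5 / 2 * (tail m / \<eta> + \<eta>) < e / 2"
    proof -
      have "5 / 2 * (tail m / \<eta> + \<eta>) < 5 / 2 * (\<eta> + \<eta>)" using t by simp
      then show ?thesis by (simp add: \<eta>_def)
    qed
    ultimately have "(LINT w|M. \<bar>residual n w\<bar>) < e" using elim(1) by linarith
    then show ?case by (simp add: integral_nonneg_AE)
  qed
  then show "\<exists>no. \<forall>n\<ge>no. norm ((LINT w|M. \<bar>residual n w\<bar>) - 0) < e"
    by (simp only: eventually_sequentially)
qed

lemma residual_tendsto_0_in_prob:
  assumes "\<delta> > 0"
  shows "(\<lambda>n. prob {w \<in> space M. \<bar>residual n w\<bar> \<ge> \<delta>}) \<longlonglongrightarrow> 0"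
proof (rule tendsto_sandwich[OF _ _ tendsto_const])
  have "(\<lambda>n. (LINT w|M. \<bar>residual n w\<bar>) / \<delta>) \<longlonglongrightarrow> 0 / \<delta>"
    by (intro tendsto_intros expectation_abs_residual_tendsto_0) (use assms in auto)
  then show "(\<lambda>n. (LINT w|M. \<bar>residual n w\<bar>) / \<delta>) \<longlonglongrightarrow> 0" by simp
  show "eventually (\<lambda>n. prob {w \<in> space M. \<bar>residual n w\<bar> \<ge> \<delta>} \<le> (LINT w|M. \<bar>residual n w\<bar>) / \<delta>) sequentially"
    using eventually_ge_at_top[of 2]
  proof eventually_elim
    case (elim n)
    have "integrable M (residual n)"
      \<comment> \<open>Only integrability is wanted, so the cut-off time and the parameter are
        arbitrary.\<close>
      by (rule expectation_abs_residual_le(1)[of 1 n 1]) (use elim in auto)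
    then show ?case
      by (intro integral_Markov_inequality_measure[where A="{}"]) (use assms in auto)
  qed
qed auto

text \<open>Pathwise averaging: \<open>energy\<close> is the sum of the squares of
  \<open>mart\<close> weighted by the squared weights, whose total is the squared scale.\<close>

lemma energy_ratio_tendsto:
  "AE w in M. (\<lambda>n. sqrt (energy n w) / clt_scale n) \<longlonglongrightarrow> \<bar>L w\<bar>"
  using mart_tendsto
proof eventually_elim
  case (elim w)
  have "(\<lambda>n. (\<Sum>k=1..<n. (weight a k)\<^sup>2 * (mart k w)\<^sup>2) / (\<Sum>k=1..<n. (weight a k)\<^sup>2)) \<longlonglongrightarrow> (L w)\<^sup>2"
  proof (rule weighted_average_tendsto)
    show "filterlim (\<lambda>n. \<Sum>k=1..<n. (weight a k)\<^sup>2) at_top sequentially"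
      using weight_norm_sq_at_top[of a] a_bounds(1) by (simp add: weight_norm_sq_def[abs_def])
  qed (use elim in \<open>auto intro!: tendsto_intros\<close>)
  moreover have "(\<Sum>k=1..<n. (weight a k)\<^sup>2 * (mart k w)\<^sup>2) = energy n w" for n
    unfolding energy_def by (intro sum.cong) (auto simp only: S_div_eq power_mult_distrib atLeastLessThan_iff)
  ultimately have "(\<lambda>n. energy n w / weight_norm_sq a n) \<longlonglongrightarrow> (L w)\<^sup>2"
    by (simp add: weight_norm_sq_def)
  then have "(\<lambda>n. sqrt (energy n w / weight_norm_sq a n)) \<longlonglongrightarrow> sqrt ((L w)\<^sup>2)"
    by (rule tendsto_real_sqrt)
  then show ?case by (simp add: real_sqrt_divide clt_scale_def)
qed

text \<open>The thresholds are proportional to |L|, so that after division by |L| the two errors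
  together change the half-width t by at most \<delta>.\<close>

definition far :: "real \<Rightarrow> real \<Rightarrow> nat \<Rightarrow> 'a \<Rightarrow> bool" where
  "far t \<delta> n w \<longleftrightarrow> L w \<noteq> 0 \<and>
    (\<bar>residual n w\<bar> \<ge> \<delta> * \<bar>L w\<bar> / 2 \<or> t * \<bar>sqrt (energy n w) / clt_scale n - \<bar>L w\<bar>\<bar> \<ge> \<delta> * \<bar>L w\<bar> / 2)"

lemma far_measurable [measurable]: "{w \<in> space M. far t \<delta> n w} \<in> events"
  unfolding far_def by measurable

text \<open>The residual is small in probability only against a constant threshold, but |L| may be
  arbitrarily small. A set of small probability where 0 < |L| < 1 / (k + 1) is removed first; off it
  the threshold is bounded below. The other condition is handled pathwise.\<close>

lemma prob_far_tendsto_0: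
  assumes \<delta>: "\<delta> > 0"
  shows "(\<lambda>n. prob {w \<in> space M. far t \<delta> n w}) \<longlonglongrightarrow> 0"
proof (rule LIMSEQ_I)
  fix e :: real assume e: "e > 0"
  let ?small = "\<lambda>k w. L w \<noteq> 0 \<and> \<bar>L w\<bar> < 1 / real (Suc k)"
  let ?ratio = "\<lambda>n w. L w \<noteq> 0 \<and> t * \<bar>sqrt (energy n w) / clt_scale n - \<bar>L w\<bar>\<bar> \<ge> \<delta> * \<bar>L w\<bar> / 2"
  have "(\<lambda>k. prob {w \<in> space M. ?small k w}) \<longlonglongrightarrow> 0"
  proof (rule prob_tendsto_0)
    show "AE w in M. eventually (\<lambda>k. \<not> ?small k w) sequentially"
    proof (rule AE_I2)
      fix w
      show "eventually (\<lambda>k. \<not> ?small k w) sequentially"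
      proof (cases "L w = 0")
        case False
        have "(\<lambda>k. 1 / real (Suc k)) \<longlonglongrightarrow> 0"
          using LIMSEQ_inverse_real_of_nat by (simp add: inverse_eq_divide)
        then have "eventually (\<lambda>k. 1 / real (Suc k) < \<bar>L w\<bar>) sequentially"
          by (rule order_tendstoD) (use False in simp)
        then show ?thesis by eventually_elim simp
      qed simp
    qed
  qed measurable
  then have "eventually (\<lambda>k. prob {w \<in> space M. ?small k w} < e / 3) sequentially"
    by (rule order_tendstoD) (use e in simp)
  then obtain k where k: "prob {w \<in> space M. ?small k w} < e / 3"
    by (auto simp: eventually_sequentially)
  define \<eta> where "\<eta> = \<delta> * (1 / real (Suc k)) / 2"
  have \<eta>: "\<eta> > 0" using \<delta> by (simp add: \<eta>_def)
  have res: "eventually (\<lambda>n. prob {w \<in> space M. \<bar>residual n w\<bar> \<ge> \<eta>} < e / 3) sequentially"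
    using residual_tendsto_0_in_prob[OF \<eta>] by (rule order_tendstoD) (use e in simp)
  have "(\<lambda>n. prob {w \<in> space M. ?ratio n w}) \<longlonglongrightarrow> 0"
  proof (rule prob_tendsto_0)
    show "AE w in M. eventually (\<lambda>n. \<not> ?ratio n w) sequentially"
      using energy_ratio_tendsto
    proof eventually_elim
      case (elim w)
      show ?case
      proof (cases "L w = 0")
        case False
        have "(\<lambda>n. t * \<bar>sqrt (energy n w) / clt_scale n - \<bar>L w\<bar>\<bar>) \<longlonglongrightarrow> t * \<bar>\<bar>L w\<bar> - \<bar>L w\<bar>\<bar>"
          by (intro tendsto_intros elim)
        then have "eventually (\<lambda>n. t * \<bar>sqrt (energy n w) / clt_scale n - \<bar>L w\<bar>\<bar> < \<delta> * \<bar>L w\<bar> / 2) sequentially"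
          by (rule order_tendstoD) (use False \<delta> in simp)
        then show ?thesis by eventually_elim simp
      qed simp
    qed
  qed measurable
  then have "eventually (\<lambda>n. prob {w \<in> space M. ?ratio n w} < e / 3) sequentially"
    by (rule order_tendstoD) (use e in simp)
  with res have "eventually (\<lambda>n. norm (prob {w \<in> space M. far t \<delta> n w} - 0) < e) sequentially"
  proof eventually_elim
    case (elim n)
    let ?U = "{w \<in> space M. ?small k w} \<union> {w \<in> space M. \<bar>residual n w\<bar> \<ge> \<eta>}"
    have "{w \<in> space M. far t \<delta> n w} \<subseteq> ?U \<union> {w \<in> space M. ?ratio n w}"
    proof
      fix w assume w: "w \<in> {w \<in> space M. far t \<delta> n w}"
      have "\<eta> \<le> \<delta> * \<bar>L w\<bar> / 2" if "\<not> \<bar>L w\<bar> < 1 / real (Suc k)"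
        unfolding \<eta>_def using that \<delta> by (intro divide_right_mono mult_left_mono) auto
      then show "w \<in> ?U \<union> {w \<in> space M. ?ratio n w}"
        using w by (cases "\<bar>L w\<bar> < 1 / real (Suc k)") (auto simp: far_def)
    qed
    then have "prob {w \<in> space M. far t \<delta> n w} \<le> prob (?U \<union> {w \<in> space M. ?ratio n w})"
      by (rule finite_measure_mono) measurable
    also have "\<dots> \<le> prob ?U + prob {w \<in> space M. ?ratio n w}"
      by (rule measure_Un_le) measurable
    also have "prob ?U \<le> prob {w \<in> space M. ?small k w} + prob {w \<in> space M. \<bar>residual n w\<bar> \<ge> \<eta>}"
      by (rule measure_Un_le) measurable
    finally have "prob {w \<in> space M. far t \<delta> n w} < e" using k elim by linarith
    then show ?case by simp
  qed
  then show "\<exists>no. \<forall>n\<ge>no. norm (prob {w \<in> space M. far t \<delta> n w} - 0) < e"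
    by (simp only: eventually_sequentially)
qed

text \<open>Dividing the score by the scale gives L times \<open>clt_sum n\<close> plus the
  residual, and t times the normalised root of \<open>energy\<close> is close to t |L|. Each
  replacement costs at most \<delta> |L| / 2, and |L| cancels.\<close>

lemma not_far_bounds:
  assumes "\<not> far t \<delta> n w" "L w \<noteq> 0" "n \<ge> 2" "t \<ge> 0"
  shows "\<bar>score n w\<bar> \<le> t * sqrt (energy n w) \<Longrightarrow> \<bar>clt_sum n w\<bar> \<le> t + \<delta>"
    and "\<bar>clt_sum n w\<bar> \<le> t - \<delta> \<Longrightarrow> \<bar>score n w\<bar> \<le> t * sqrt (energy n w)"
proof -
  have s: "clt_scale n > 0" using clt_scale_ge_1[OF assms(3)] by linarith
  define l where "l = \<bar>L w\<bar>"
  define g where "g = sqrt (energy n w) / clt_scale n"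
  have l: "l > 0" using assms(2) by (simp add: l_def)
  have r: "\<bar>residual n w\<bar> < \<delta> * l / 2" and tg: "t * \<bar>g - l\<bar> < \<delta> * l / 2"
    using assms(1,2) by (auto simp: far_def l_def g_def)
  have tg1: "t * g \<le> t * l + \<delta> * l / 2" and tg2: "t * g \<ge> t * l - \<delta> * l / 2"
  proof -
    have "t * (g - l) \<le> t * \<bar>g - l\<bar>" "t * (l - g) \<le> t * \<bar>g - l\<bar>"
      using assms(4) by (intro mult_left_mono; simp)+
    then show "t * g \<le> t * l + \<delta> * l / 2" "t * g \<ge> t * l - \<delta> * l / 2"
      using tg by (auto simp: right_diff_distrib)
  qed
  have eq: "score n w / clt_scale n = L w * clt_sum n w + residual n w"
    by (simp add: residual_def)
  have abs: "\<bar>L w * clt_sum n w\<bar> = l * \<bar>clt_sum n w\<bar>" by (simp add: l_def abs_mult)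
  have score: "\<bar>score n w\<bar> \<le> t * sqrt (energy n w) \<longleftrightarrow> \<bar>score n w / clt_scale n\<bar> \<le> t * g"
    using s by (simp add: g_def abs_divide divide_le_cancel)
  show "\<bar>clt_sum n w\<bar> \<le> t + \<delta>" if "\<bar>score n w\<bar> \<le> t * sqrt (energy n w)"
  proof -
    have "l * \<bar>clt_sum n w\<bar> \<le> \<bar>score n w / clt_scale n\<bar> + \<bar>residual n w\<bar>"
      using eq abs by linarith
    also have "\<dots> \<le> t * l + \<delta> * l" using that score r tg1 by linarith
    finally have "l * \<bar>clt_sum n w\<bar> \<le> l * (t + \<delta>)" by (simp add: algebra_simps)
    then show ?thesis using l by (simp add: mult_le_cancel_left_pos)
  qed
  show "\<bar>score n w\<bar> \<le> t * sqrt (energy n w)" if "\<bar>clt_sum n w\<bar> \<le> t - \<delta>"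
  proof -
    have "l * \<bar>clt_sum n w\<bar> \<le> l * (t - \<delta>)" using that l by (intro mult_left_mono) auto
    then have "\<bar>score n w / clt_scale n\<bar> \<le> l * (t - \<delta>) + \<delta> * l / 2"
      using eq abs r by linarith
    also have "\<dots> \<le> t * g" using tg2 by (simp add: algebra_simps)
    finally show ?thesis using score by simp
  qed
qed

text \<open>A Slutsky argument: off the exceptional events the random inequality lies between the
  inequalities for \<open>clt_sum n\<close> with half-widths t - \<delta> and t + \<delta>, whose
  limits are close by continuity.\<close>

lemma studentized_clt:
  assumes t: "t > 0"
  shows "(\<lambda>n. prob {w \<in> space M. \<bar>score n w\<bar> \<le> t * sqrt (energy n w) \<and> L w \<noteq> 0})
    \<longlonglongrightarrow> prob A * measure std_normal_distribution {- t..t}"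
proof (rule LIMSEQ_I)
  fix e :: real assume e: "e > 0"
  define F where "F s = prob A * measure std_normal_distribution {- s..s}" for s
  define f where "f n s = prob {w \<in> space M. \<bar>clt_sum n w\<bar> \<le> s \<and> L w \<noteq> 0}" for n s
  define r where "r n = prob {w \<in> space M. \<bar>score n w\<bar> \<le> t * sqrt (energy n w) \<and> L w \<noteq> 0}" for n
  have "isCont F t"
    unfolding F_def by (intro continuous_intros isCont_std_normal_symmetric_interval t)
  then obtain d where d: "d > 0" "\<And>s. \<bar>s - t\<bar> < d \<Longrightarrow> \<bar>F s - F t\<bar> < e / 3"
    unfolding continuous_at_eps_delta dist_real_def using e by (metis divide_pos_pos zero_less_numeral)
  \<comment> \<open>The bound by t keeps t - \<delta> nonnegative, as the limit theorem on A
    requires.\<close>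
  define \<delta> where "\<delta> = min (d / 2) t"
  have \<delta>: "\<delta> > 0" "\<delta> < d" "\<delta> \<le> t" using d t by (auto simp: \<delta>_def)
  have lim: "eventually (\<lambda>n. \<bar>f n s - F s\<bar> < e / 3) sequentially" if "s \<ge> 0" for s
    using LIMSEQ_D[OF clt_on_A[OF that], of "e / 3"] e
    by (simp add: eventually_sequentially f_def F_def)
  have F: "\<bar>F (t + \<delta>) - F t\<bar> < e / 3" "\<bar>F (t - \<delta>) - F t\<bar> < e / 3"
    by (rule d(2), use \<delta> in simp)+
  have "eventually (\<lambda>n. prob {w \<in> space M. far t \<delta> n w} < e / 3) sequentially"
    using prob_far_tendsto_0[OF \<delta>(1)] by (rule order_tendstoD) (use e in simp)
  moreover have "eventually (\<lambda>n. \<bar>f n (t + \<delta>) - F (t + \<delta>)\<bar> < e / 3) sequentially"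
    "eventually (\<lambda>n. \<bar>f n (t - \<delta>) - F (t - \<delta>)\<bar> < e / 3) sequentially"
    by (rule lim, use \<delta> t in simp)+
  ultimately have "eventually (\<lambda>n. norm (r n - F t) < e) sequentially"
    using eventually_ge_at_top[of 2]
  proof eventually_elim
    case (elim n)
    have "r n \<le> prob ({w \<in> space M. \<bar>clt_sum n w\<bar> \<le> t + \<delta> \<and> L w \<noteq> 0} \<union> {w \<in> space M. far t \<delta> n w})"
      unfolding r_def
      by (rule finite_measure_mono) (use not_far_bounds(1)[of t \<delta> n] elim t in auto)
    also have "\<dots> \<le> f n (t + \<delta>) + prob {w \<in> space M. far t \<delta> n w}"
      unfolding f_def by (rule measure_Un_le) measurable
    finally have upper: "r n \<le> f n (t + \<delta>) + prob {w \<in> space M. far t \<delta> n w}" .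
    have "f n (t - \<delta>) \<le> prob ({w \<in> space M. \<bar>score n w\<bar> \<le> t * sqrt (energy n w) \<and> L w \<noteq> 0} \<union> {w \<in> space M. far t \<delta> n w})"
      unfolding f_def
      by (rule finite_measure_mono) (use not_far_bounds(2)[of t \<delta> n] elim t in auto)
    also have "\<dots> \<le> r n + prob {w \<in> space M. far t \<delta> n w}"
      unfolding r_def by (rule measure_Un_le) measurable
    finally have lower: "f n (t - \<delta>) \<le> r n + prob {w \<in> space M. far t \<delta> n w}" .
    show ?case using upper lower elim F unfolding real_norm_def by linarith
  qed
  then show "\<exists>no. \<forall>n\<ge>no. norm (prob {w \<in> space M. \<bar>score n w\<bar> \<le> t * sqrt (energy n w) \<and> L w \<noteq> 0}
      - prob A * measure std_normal_distribution {- t..t}) < e"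
    by (simp only: eventually_sequentially r_def F_def)
qed

section \<open>Coverage of the confidence interval\<close>

lemma AE_energy_ge_1: "n \<ge> 2 \<Longrightarrow> AE w in M. energy n w \<ge> 1"
  using AE_X_values
proof eventually_elim
  case (elim w)
  \<comment> \<open>The term k = 1 alone equals 1, so almost surely the denominators in the
    estimator and in the interval are nonzero for n \<ge> 2.\<close>
  have "(S 1 w / real 1)\<^sup>2 \<le> energy n w"
    unfolding energy_def using elim(1) by (intro member_le_sum) auto
  moreover have "(S 1 w)\<^sup>2 = 1" using elim(2) by (auto simp: position_def)
  ultimately show ?case by simp
qed

lemma mem_conf_interval_iff:
  assumes n: "n \<ge> 1" and E: "energy n w > 0"
  shows "p \<in> conf_interval X \<alpha> n w \<longleftrightarrow>
    \<bar>score n w\<bar> \<le> quantile std_normal_distribution (1 - \<alpha> / 2) * sqrt (energy n w)"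
proof -
  define t where "t = quantile std_normal_distribution (1 - \<alpha> / 2)"
  define E where "E = energy n w"
  define c where "c = score n w"
  have E0: "E > 0" using E by (simp add: E_def)
  have range: "{1..n - 1} = {1..<n}" using n by auto
  \<comment> \<open>Since a + 1 = 2 p, the sum of X_(k+1) and S_k / k is the noise plus 2 p S_k / k;
    the second part produces p itself in the estimator.\<close>
  have "(\<Sum>k=1..n - 1. S k w / real k * (X (k + 1) w + S k w / real k)) =
      (\<Sum>k=1..<n. S k w / real k * noise k w + 2 * p * (S k w / real k)\<^sup>2)"
    unfolding range noise_def by (intro sum.cong) (auto simp: power2_eq_square algebra_simps simp del: times_divide_eq_left times_divide_eq_right)
  also have "\<dots> = c + 2 * p * E"
    by (simp only: sum.distrib c_def E_def score_def energy_def sum_distrib_left)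
  finally have "p_hat X n w = (c + 2 * p * E) / (2 * E)"
    by (simp only: p_hat_def range E_def energy_def)
  then have p_hat: "p_hat X n w = p + c / (2 * E)"
    using E0 by (simp add: field_simps)
  have "V X n w = 4 * E"
    by (simp only: V_def range E_def energy_def)
  then have V: "sqrt (V X n w) = 2 * sqrt E"
    by (simp add: real_sqrt_mult)
  have "p \<in> {p + x - y..p + x + y} \<longleftrightarrow> \<bar>x\<bar> \<le> y" for x y :: real
    by auto
  then have "p \<in> conf_interval X \<alpha> n w \<longleftrightarrow> \<bar>c / (2 * E)\<bar> \<le> 1 / (2 * sqrt E) * t"
    unfolding conf_interval_def Let_def p_hat V t_def[symmetric] .
  also have "1 / (2 * sqrt E) * t = t * sqrt E / (2 * E)"
    using E0 by (simp add: field_simps flip: power2_eq_square)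
  also have "\<bar>c / (2 * E)\<bar> \<le> t * sqrt E / (2 * E) \<longleftrightarrow> \<bar>c\<bar> \<le> t * sqrt E"
    using E0 by (simp add: abs_divide divide_le_cancel)
  finally show ?thesis by (simp add: t_def E_def c_def)
qed

lemma conf_interval_measurable:
  "{w \<in> space M. p \<in> conf_interval X \<alpha> n w} \<in> events"
proof -
  have [measurable]: "X k \<in> borel_measurable M" if "k \<ge> 1" for k using that by (rule X_measurable)
  have [measurable]: "p_hat X n \<in> borel_measurable M"
    unfolding p_hat_def
    by (intro borel_measurable_divide borel_measurable_sum borel_measurable_times borel_measurable_add
        borel_measurable_const borel_measurable_power S_measurable X_measurable) auto
  have [measurable]: "V X n \<in> borel_measurable M"
    unfolding V_def by measurable
  show ?thesis
    unfolding conf_interval_def Let_def atLeastAtMost_iff by measurable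
qed

lemma coverage_tendsto:
  assumes "0 < \<alpha>" "\<alpha> < 1"
  shows "(\<lambda>n. \<P>(w in M. p \<in> conf_interval X \<alpha> n w \<bar> L w \<noteq> 0)) \<longlonglongrightarrow> 1 - \<alpha>"
proof -
  let ?t = "quantile std_normal_distribution (1 - \<alpha> / 2)"
  have "(\<lambda>n. prob {w \<in> space M. \<bar>score n w\<bar> \<le> ?t * sqrt (energy n w) \<and> L w \<noteq> 0} / prob A) \<longlonglongrightarrow> prob A * (1 - \<alpha>) / prob A"
    using studentized_clt[OF std_normal_quantile_interval(1)[OF assms]] std_normal_quantile_interval(2)[OF assms] prob_A_pos
    by (intro tendsto_intros) auto
  moreover have "eventually (\<lambda>n. prob {w \<in> space M. \<bar>score n w\<bar> \<le> ?t * sqrt (energy n w) \<and> L w \<noteq> 0} / prob A =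
      \<P>(w in M. p \<in> conf_interval X \<alpha> n w \<bar> L w \<noteq> 0)) sequentially"
    using eventually_ge_at_top[of 2]
  proof eventually_elim
    case (elim n)
    have [measurable]: "Measurable.pred M (\<lambda>w. p \<in> conf_interval X \<alpha> n w)"
      using conf_interval_measurable by (simp add: pred_def)
    have "prob {w \<in> space M. \<bar>score n w\<bar> \<le> ?t * sqrt (energy n w) \<and> L w \<noteq> 0} =
        prob {w \<in> space M. p \<in> conf_interval X \<alpha> n w \<and> L w \<noteq> 0}"
    proof (rule prob_eq_AE)
      show "AE w in M. (\<bar>score n w\<bar> \<le> ?t * sqrt (energy n w) \<and> L w \<noteq> 0) \<longleftrightarrow> (p \<in> conf_interval X \<alpha> n w \<and> L w \<noteq> 0)"
        using AE_energy_ge_1[OF elim]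
      proof eventually_elim
        case (elim w)
        then show ?case using mem_conf_interval_iff[of n w \<alpha>] \<open>n \<ge> 2\<close> by auto
      qed
    qed measurable
    then show ?case by (simp add: cond_prob_def A_def)
  qed
  ultimately show ?thesis
    using prob_A_pos by (simp add: filterlim_cong)
qed

end

(* The value p = 1 is excluded: there X n = X 1 almost surely for all n, hence p_hat X n = 1 = p
   almost surely, and the coverage probability is 1 for every n \<ge> 2 instead of tending to 1 - \<alpha>. *)
theorem theorem3p10:
  fixes M :: "'a measure"
    and p q \<alpha> :: real
    and X :: "nat \<Rightarrow> 'a \<Rightarrow> real"
    and K :: "nat \<Rightarrow> 'a \<Rightarrow> nat"
    and Z :: "nat \<Rightarrow> 'a \<Rightarrow> bool"
    and L :: "'a \<Rightarrow> real"
  assumes "elephant_random_walk M p q X K Z"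
    and "3 / 4 < p" and "p < 1"
    and "L \<in> borel_measurable M"
    and "AE w in M. (\<lambda>n. position X n w / real n powr (2 * p - 1)) \<longlonglongrightarrow> L w"
    and "0 < \<alpha>" and "\<alpha> < 1"
  shows "(\<lambda>n. \<P>(w in M. p \<in> conf_interval X \<alpha> n w \<bar> (L w)\<^sup>2 > 0)) \<longlonglongrightarrow> 1 - \<alpha>"
proof -
  interpret superdiffusive_erw M p q X K Z
    using assms by (intro superdiffusive_erw.intro superdiffusive_erw_axioms.intro)
  \<comment> \<open>The hypothesis normalises the walk by a power of n, the martingale by
    \<open>growth\<close>. The ratio of the two has the positive limit \<rho>, so dividing L by it
    does not change where L vanishes.\<close>
  obtain \<rho> where \<rho>: "\<rho> > 0" "(\<lambda>n. growth a n / real n powr a) \<longlonglongrightarrow> \<rho>"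
    using growth_asymptotics[OF a_bounds(2)] by metis
  have "AE w in M. (\<lambda>n. mart n w) \<longlonglongrightarrow> L w / \<rho>"
    using assms(5)
  proof eventually_elim
    case (elim w)
    have "(\<lambda>n. (position X n w / real n powr a) / (growth a n / real n powr a)) \<longlonglongrightarrow> L w / \<rho>"
      using elim \<rho> by (intro tendsto_divide) auto
    moreover have "eventually (\<lambda>n. (position X n w / real n powr a) / (growth a n / real n powr a) = mart n w) sequentially"
      using eventually_ge_at_top[of 1] by eventually_elim (simp add: mart_def)
    ultimately show ?case by (rule Lim_transform_eventually)
  qed
  then interpret superdiffusive_limit M p q X K Z "\<lambda>w. L w / \<rho>"
    using assms(4) by unfold_locales auto
  show ?thesis
    using coverage_tendsto[OF assms(6,7)] \<rho>(1) by simp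
qed

end
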